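(* Let $k$ be a positive integer and $N=2k$. Let $Q_1,Q_2$ be real-valued functions on $\mathbb{H}^N$. Suppose $Q_1-Q_2\in L^2(\mathbb{H}^N)$ and $Q_2\le 0$. Then the equation $$P_k(u)+Q_1=Q_2\,e^{2u}\quad\text{on }\mathbb{H}^N$$ has a solution $u\in H^k(\mathbb{H}^N)$.
   Context: Functions are real-valued. $\mathbb{H}^N$ is the ball model of hyperbolic space: the open unit ball $\mathbb{B}^N\subset\mathbb{R}^N$ with the metric $g=\left(\frac{2}{1-|x|^2}\right)^2\sum_{i=1}^N dx_i^2$, volume element $dv_g=\left(\frac{2}{1-|x|^2}\right)^N dx$, gradient $\nabla_g=\left(\frac{1-|x|^2}{2}\right)^2\nabla$ and Laplace–Beltrami operator $\Delta_g$. $L^2(\mathbb{H}^N)$ is taken with respect to $dv_g$. For a nonnegative integer $m$, $\nabla_g^m:=\Delta_g^{m/2}$ if $m$ is even and $\nabla_g^m:=\nabla_g\Delta_g^{(m-1)/2}$ if $m$ is odd; $|\nabla_g^m u|_g$ is the absolute value if $m$ is even and the $g$-length of the vector if $m$ is odd. $H^k(\mathbb{H}^N)$ is the completion of $C_c^\infty(\mathbb{H}^N)$ with respect to the norm $\|u\|_{H^k(\mathbb{H}^N)}=\left[\sum_{m=0}^k\int_{\mathbb{H}^N}|\nabla_g^mu|_g^2\,dv_g\right]^{1/2}$. GJMS operators on $\mathbb{H}^N$: $P_1=-\Delta_g-\frac{N(N-2)}{4}$ and $P_k=P_1(P_1+2)(P_1+6)\cdots(P_1+k(k-1))=\prod_{j=1}^k\bigl(P_1+j(j-1)\bigr)$;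 for $N=2k$ this is the critical GJMS operator. A solution $u\in H^k(\mathbb{H}^N)$ is understood in the weak sense: $\int_{\mathbb{H}^N}(P_ku)v\,dv_g+\int_{\mathbb{H}^N}\left[Q_1-Q_2e^{2u}\right]v\,dv_g=0$ for all $v\in C_c^\infty(\mathbb{H}^N)$, where $\int_{\mathbb{H}^N}(P_ku)v\,dv_g$ means $\int_{\mathbb{H}^N}u\,P_kv\,dv_g$.
   Formalization: Q_2 (hence also Q_1) is assumed locally integrable on H^N; for arbitrary real-valued functions the claim fails, e.g. when -Q_2 = sum of 2^{-j}/|x_1-q_j| with (q_j) dense in (-1,1) and Q_1-Q_2 is a nonzero L^2 function. *)

theory Defs
  imports "HOL-Analysis.Analysis"
begin

(* Hyperbolic space of dimension DIM('a) is the unit ball "ball 0 1" of 'a with the metric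
   (hyp_factor x)^2 * (Euclidean metric).  Functions on it are total functions on 'a whose
   values off the ball are irrelevant. *)

definition hyp_factor :: "'a::euclidean_space \<Rightarrow> real"
  where "hyp_factor x = 2 / (1 - (norm x)\<^sup>2)"

definition hyp_vol :: "'a::euclidean_space measure"
  where "hyp_vol = density (lebesgue_on (ball 0 1)) (\<lambda>x. ennreal (hyp_factor x ^ DIM('a)))"

definition partial :: "'a::euclidean_space \<Rightarrow> ('a \<Rightarrow> real) \<Rightarrow> 'a \<Rightarrow> real"
  where "partial b f x = frechet_derivative f (at x) b"

definition hyp_grad :: "('a::euclidean_space \<Rightarrow> real) \<Rightarrow> 'a \<Rightarrow> 'a"
  where "hyp_grad f x = (1 / (hyp_factor x)\<^sup>2) *\<^sub>R (\<Sum>b\<in>Basis. partial b f x *\<^sub>R b)"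

(* Riemannian divergence (1 / sqrt |g|) * sum_i d_i (sqrt |g| * X^i), where sqrt |g| = hyp_factor ^ N. *)
definition hyp_div :: "('a::euclidean_space \<Rightarrow> 'a) \<Rightarrow> 'a \<Rightarrow> real"
  where "hyp_div X x =
    (\<Sum>b\<in>Basis. partial b (\<lambda>y. hyp_factor y ^ DIM('a) * (X y \<bullet> b)) x) / hyp_factor x ^ DIM('a)"

definition hyp_laplace :: "('a::euclidean_space \<Rightarrow> real) \<Rightarrow> 'a \<Rightarrow> real"
  where "hyp_laplace f = hyp_div (hyp_grad f)"

(* The g-length of a tangent vector X at x is hyp_factor x * norm X. *)
definition hyp_nabla_norm :: "nat \<Rightarrow> ('a::euclidean_space \<Rightarrow> real) \<Rightarrow> 'a \<Rightarrow> real"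
  where "hyp_nabla_norm m f x =
    (if even m then \<bar>(hyp_laplace ^^ (m div 2)) f x\<bar>
     else hyp_factor x * norm (hyp_grad ((hyp_laplace ^^ ((m - 1) div 2)) f) x))"

primrec cont_diff :: "nat \<Rightarrow> ('a::euclidean_space \<Rightarrow> real) \<Rightarrow> bool"
  where
    "cont_diff 0 f \<longleftrightarrow> continuous_on UNIV f"
  | "cont_diff (Suc n) f \<longleftrightarrow>
      (\<forall>x. f differentiable (at x)) \<and> (\<forall>b\<in>Basis. cont_diff n (partial b f))"

(* C_c^infinity of the open ball, each function being extended by zero. *)
definition test_functions :: "('a::euclidean_space \<Rightarrow> real) set"
  where "test_functions =
    {f. (\<forall>n. cont_diff n f) \<and> (\<exists>K. compact K \<and> K \<subseteq> ball 0 1 \<and> (\<forall>x. x \<notin> K \<longrightarrow> f x = 0))}"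

definition hyp_L2 :: "('a::euclidean_space \<Rightarrow> real) set"
  where "hyp_L2 = {f. f \<in> borel_measurable hyp_vol \<and> integrable hyp_vol (\<lambda>x. (f x)\<^sup>2)}"

(* "Real-valued function" is read as L^1_loc for the coefficients of the equation, so that each term
   of its weak form is defined; given Q1 - Q2 in L^2, requiring it of Q2 also gives it for Q1. *)
definition hyp_locally_integrable :: "('a::euclidean_space \<Rightarrow> real) \<Rightarrow> bool"
  where "hyp_locally_integrable f \<longleftrightarrow>
    (\<forall>K. compact K \<and> K \<subseteq> ball 0 1 \<longrightarrow> set_integrable hyp_vol K f)"

definition sobolev_norm :: "nat \<Rightarrow> ('a::euclidean_space \<Rightarrow> real) \<Rightarrow> real"
  where "sobolev_norm k f = sqrt (\<Sum>m\<le>k. \<integral>x. (hyp_nabla_norm m f x)\<^sup>2 \<partial>hyp_vol)"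

(* The completion of the test functions, realised inside L^2: the norm dominates the L^2 norm and
   its derivative terms are closable, so a Cauchy sequence determines, and up to equivalence is
   determined by, its L^2 limit. *)
definition hyp_sobolev :: "nat \<Rightarrow> ('a::euclidean_space \<Rightarrow> real) set"
  where "hyp_sobolev k =
    {u \<in> hyp_L2. \<exists>\<phi>. (\<forall>n. \<phi> n \<in> test_functions) \<and>
       (\<forall>e>0. \<exists>M. \<forall>m\<ge>M. \<forall>n\<ge>M. sobolev_norm k (\<lambda>x. \<phi> m x - \<phi> n x) < e) \<and>
       (\<lambda>n. \<integral>x. (\<phi> n x - u x)\<^sup>2 \<partial>hyp_vol) \<longlonglongrightarrow> 0}"

definition gjms1 :: "('a::euclidean_space \<Rightarrow> real) \<Rightarrow> 'a \<Rightarrow> real"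
  where "gjms1 f x = - hyp_laplace f x - real DIM('a) * (real DIM('a) - 2) / 4 * f x"

(* gjms k = P_1 (P_1 + 2) (P_1 + 6) ... (P_1 + k (k - 1)), the last factor being applied first. *)
primrec gjms :: "nat \<Rightarrow> ('a::euclidean_space \<Rightarrow> real) \<Rightarrow> 'a \<Rightarrow> real"
  where
    "gjms 0 f = f"
  | "gjms (Suc k) f = gjms k (\<lambda>x. gjms1 f x + real (Suc k * k) * f x)"

(* Weak form of P_k u + Q1 = Q2 * exp (2 * u).  Integrability is demanded explicitly because
   the integral of a non-integrable function is 0 by convention. *)
definition weak_solution ::
    "nat \<Rightarrow> ('a::euclidean_space \<Rightarrow> real) \<Rightarrow> ('a \<Rightarrow> real) \<Rightarrow> ('a \<Rightarrow> real) \<Rightarrow> bool"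
  where "weak_solution k Q1 Q2 u \<longleftrightarrow>
    (\<forall>v\<in>test_functions.
       integrable hyp_vol (\<lambda>x. u x * gjms k v x) \<and>
       integrable hyp_vol (\<lambda>x. (Q1 x - Q2 x * exp (2 * u x)) * v x) \<and>
       (\<integral>x. u x * gjms k v x \<partial>hyp_vol)
         + (\<integral>x. (Q1 x - Q2 x * exp (2 * u x)) * v x \<partial>hyp_vol) = 0)"

end

theory Submission
  imports Defs
begin

text \<open>Put \<open>h = Q1 - Q2\<close> and \<open>w = - Q2 \<ge> 0\<close>.  The equation is the Euler--Lagrange equation of the strongly
  convex energy \<open>\<langle>P u, u\<rangle> / 2 + \<integral> h u + \<integral> w (exp (2 u) - 1 - 2 u) / 2\<close>, where \<open>P\<close> is the critical GJMS
  operator.  On \<open>N\<close>-dimensional hyperbolic space \<open>-\<Delta>\<close> has spectral gap \<open>(N - 1)\<^sup>2 / 4\<close>, so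
  \<open>P_1 \<ge> 1 / 4\<close>, and the quadratic form of \<open>P\<close>, a product of \<open>k\<close> nonnegative shifts of \<open>P_1\<close>, dominates
  the square of the \<open>H^k\<close> norm up to a constant.

  The energy is minimised over test functions only.  Strong convexity makes minimising sequences
  Cauchy in \<open>H^k\<close>, so no weak compactness is needed.  The limit \<open>u\<close> need not be bounded and \<open>w\<close> is only
  locally integrable, so the delicate point is passing to the limit in \<open>w exp (2 \<psi>_n)\<close>: comparing the
  energy of a near-minimiser with that of its slight shrinking towards \<open>0\<close> bounds
  \<open>\<integral> w \<psi>_n (exp (2 \<psi>_n) - 1)\<close>, which gives uniform integrability on compact sets.\<close>


section \<open>Minimisation of convex energies with exponential growth\<close>

text \<open>The energy is never evaluated at the limit: on a general \<open>H^k\<close> function the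
  exponential term may be infinite, while on bounded functions of compact support it is finite
  although \<open>w\<close> is only locally integrable. The Euler-Lagrange equation is therefore
  extracted at the approximants. Each \<open>\<psi> n\<close> is perturbed by \<open>s n * v\<close>
  with \<open>s n = (1/4)^n\<close>, and its energy exceeds the infimum by at most
  \<open>K * (1/16)^n\<close>; after division by \<open>s n\<close> the error
  \<open>K * (1/4)^n\<close> still tends to 0. The limit yields an inequality for every
  \<open>v\<close>, and \<open>v\<close> and \<open>- v\<close> together give equality.

  Shrinking is needed because a small energy gap alone does not bound the derivative of the energy
  at a near-minimiser: the second derivative is unbounded. Convexity does bound the derivative at
  the shrunk point by a difference quotient, and gap and step are both taken equal to
  \<open>e\<close>, so the quotient is at most 1.\<close>

lemma integrable_mult_L2:
  fixes f g :: "'a \<Rightarrow> real"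
  assumes "f \<in> borel_measurable M" "g \<in> borel_measurable M"
    and "integrable M (\<lambda>x. (f x)\<^sup>2)" "integrable M (\<lambda>x. (g x)\<^sup>2)"
  shows "integrable M (\<lambda>x. f x * g x)"
proof (rule Bochner_Integration.integrable_bound)
  show "integrable M (\<lambda>x. (f x)\<^sup>2 + (g x)\<^sup>2)" using assms by simp
  have "\<bar>a * b\<bar> \<le> a\<^sup>2 + b\<^sup>2" for a b :: real
    using sum_squares_bound[of a b] sum_squares_bound[of a "- b"] by (simp add: abs_le_iff)
  then show "AE x in M. norm (f x * g x) \<le> norm ((f x)\<^sup>2 + (g x)\<^sup>2)" by simp
qed (use assms in auto)

text \<open>Serves where only a uniform bound on integrals is at hand and no dominating function:
  for the \<open>L^2\<close> distance to the limit, and for the exponential weight at the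
  limit.\<close>

lemma Fatou_integral_le:
  fixes f :: "nat \<Rightarrow> 'a \<Rightarrow> real"
  assumes int: "\<And>n. integrable M (f n)" and nonneg: "\<And>n x. 0 \<le> f n x"
    and meas: "g \<in> borel_measurable M"
    and lim: "AE x in M. (\<lambda>n. f n x) \<longlonglongrightarrow> g x"
    and le: "\<And>n. (\<integral>x. f n x \<partial>M) \<le> C"
  shows "integrable M g" and "(\<integral>x. g x \<partial>M) \<le> C"
proof -
  have C: "0 \<le> C"
    using le[of 0] Bochner_Integration.integral_nonneg[of M "f 0"] nonneg by fastforce
  have g0: "AE x in M. 0 \<le> g x"
    using lim
  proof eventually_elim
    case (elim x)
    then show ?case by (rule LIMSEQ_le_const) (use nonneg in auto)
  qed
  have "(\<integral>\<^sup>+x. ennreal (g x) \<partial>M) = (\<integral>\<^sup>+x. liminf (\<lambda>n. ennreal (f n x)) \<partial>M)"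
  proof (rule nn_integral_cong_AE)
    show "AE x in M. ennreal (g x) = liminf (\<lambda>n. ennreal (f n x))"
      using lim
    proof eventually_elim
      case (elim x)
      then have "(\<lambda>n. ennreal (f n x)) \<longlonglongrightarrow> ennreal (g x)" by (rule tendsto_ennrealI)
      then show ?case by (simp add: lim_imp_Liminf)
    qed
  qed
  also have "\<dots> \<le> liminf (\<lambda>n. \<integral>\<^sup>+x. ennreal (f n x) \<partial>M)"
    using int by (intro nn_integral_liminf) auto
  also have "\<dots> \<le> liminf (\<lambda>n. ennreal C)"
    using le by (intro Liminf_mono always_eventually allI)
      (auto simp: nn_integral_eq_integral int nonneg intro: ennreal_leI)
  finally have *: "(\<integral>\<^sup>+x. ennreal (g x) \<partial>M) \<le> ennreal C" by (simp add: Liminf_const)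
  show g: "integrable M g"
    using * meas g0 by (intro integrableI_nonneg) (auto simp: le_less_trans)
  show "(\<integral>x. g x \<partial>M) \<le> C"
    using * C nn_integral_eq_integral[OF g g0] by simp
qed

lemma integral_abs_diff_le:
  fixes f g h :: "'a \<Rightarrow> real"
  assumes "integrable M f" "integrable M g" "integrable M h"
    and "\<And>x. x \<in> space M \<Longrightarrow> \<bar>f x - g x\<bar> \<le> h x"
  shows "\<bar>(\<integral>x. f x \<partial>M) - (\<integral>x. g x \<partial>M)\<bar> \<le> (\<integral>x. h x \<partial>M)"
proof -
  have "\<bar>\<integral>x. f x - g x \<partial>M\<bar> \<le> (\<integral>x. \<bar>f x - g x\<bar> \<partial>M)" by (rule integral_abs_bound)
  also have "\<dots> \<le> (\<integral>x. h x \<partial>M)" using assms by (intro integral_mono) auto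
  finally show ?thesis using assms by simp
qed

text \<open>Geometric decay of the increments gives almost everywhere convergence without passing to
  a subsequence.\<close>

lemma L2_limit_of_geometric_increments:
  fixes f :: "nat \<Rightarrow> 'a \<Rightarrow> real"
  assumes meas: "\<And>n. f n \<in> borel_measurable M"
    and int: "\<And>m n. integrable M (\<lambda>x. (f m x - f n x)\<^sup>2)"
    and bound: "\<And>m n. m \<le> n \<Longrightarrow> (\<integral>x. (f m x - f n x)\<^sup>2 \<partial>M) \<le> K * (1/16)^m"
  obtains u where "u \<in> borel_measurable M" "AE x in M. (\<lambda>n. f n x) \<longlonglongrightarrow> u x"
    "\<And>n. integrable M (\<lambda>x. (f n x - u x)\<^sup>2)"
    "(\<lambda>n. \<integral>x. (f n x - u x)\<^sup>2 \<partial>M) \<longlonglongrightarrow> 0"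
proof -
  \<comment> \<open>The weight \<open>4^n\<close> lies between the two demands: the integrals of
    \<open>d n\<close> are still at most \<open>K * (1/4)^n\<close>, hence summable, and a bound on
    \<open>d n x\<close> at a point \<open>x\<close> still makes the increments there decay like
    \<open>(1/2)^n\<close>.\<close>
  define d where "d n x = 4^n * (f n x - f (Suc n) x)\<^sup>2" for n x
  have K: "0 \<le> K"
    using bound[of 0 0] by simp
  have d0: "0 \<le> d n x" for n x
    by (simp add: d_def)
  have d_int: "integrable M (d n)" for n
    unfolding d_def using int by simp
  have d_le: "(\<integral>\<^sup>+x. ennreal (d n x) \<partial>M) \<le> ennreal (K * (1/4)^n)" for n
  proof -
    have le: "(\<integral>x. d n x \<partial>M) \<le> 4^n * (K * (1/16)^n)"
      unfolding d_def using bound[of n "Suc n"] by simp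
    also have "\<dots> = K * (1/4)^n" by (simp add: power_mult_distrib[symmetric] mult.left_commute)
    finally show ?thesis
      by (subst nn_integral_eq_integral[OF d_int]) (auto simp: d0 intro: ennreal_leI)
  qed
  have "(\<integral>\<^sup>+x. (\<Sum>n. ennreal (d n x)) \<partial>M) = (\<Sum>n. \<integral>\<^sup>+x. ennreal (d n x) \<partial>M)"
    using d_int by (intro nn_integral_suminf) auto
  also have "\<dots> \<le> (\<Sum>n. ennreal (K * (1/4)^n))"
    by (intro suminf_le d_le) auto
  also have "\<dots> < \<infinity>"
    using K by (subst suminf_ennreal2) (auto intro!: summable_mult summable_geometric)
  finally have "AE x in M. (\<Sum>n. ennreal (d n x)) \<noteq> \<infinity>"
    using d_int by (intro nn_integral_noteq_infinite) auto
  then have conv: "AE x in M. convergent (\<lambda>n. f n x)"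
  proof eventually_elim
    case (elim x)
    have "summable (\<lambda>n. d n x)"
      by (rule summable_suminf_not_top) (use elim in \<open>auto simp: d_def\<close>)
    then have "(\<lambda>n. d n x) \<longlonglongrightarrow> 0" by (rule summable_LIMSEQ_zero)
    then have "Bseq (\<lambda>n. d n x)" by (intro convergent_imp_Bseq convergentI)
    then obtain B where B: "\<And>n. \<bar>d n x\<bar> \<le> B" and B0: "0 < B" unfolding Bseq_def real_norm_def by blast
    have step: "\<bar>f (Suc n) x - f n x\<bar> \<le> sqrt B * (1/2)^n" for n
    proof (rule power2_le_imp_le)
      have "4^n * (f (Suc n) x - f n x)\<^sup>2 \<le> B"
        using B[of n] by (simp add: d_def power2_commute)
      then have "(f (Suc n) x - f n x)\<^sup>2 \<le> B * (1/4)^n"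
        by (simp add: field_simps power_one_over)
      also have "B * (1/4)^n = (sqrt B * (1/2)^n)\<^sup>2"
        using B0 by (simp add: power_mult_distrib power_mult[symmetric] mult.commute[of n])
           (simp add: power_mult power_one_over power2_eq_square)
      finally show "\<bar>f (Suc n) x - f n x\<bar>\<^sup>2 \<le> (sqrt B * (1/2)^n)\<^sup>2" by simp
    qed (use B0 in auto)
    have "summable (\<lambda>n. f (Suc n) x - f n x)"
      by (rule summable_comparison_test'[where g="\<lambda>n. sqrt B * (1/2)^n"])
         (use step in \<open>auto intro!: summable_mult summable_geometric\<close>)
    then have "(\<lambda>n. \<Sum>i<n. f (Suc i) x - f i x) \<longlonglongrightarrow> (\<Sum>n. f (Suc n) x - f n x)"
      by (rule summable_LIMSEQ)
    then have "(\<lambda>n. f n x - f 0 x) \<longlonglongrightarrow> (\<Sum>n. f (Suc n) x - f n x)"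
      by (simp add: sum_lessThan_telescope[of "\<lambda>n. f n x"])
    from tendsto_add[OF this tendsto_const[of "f 0 x"]] show ?case
      by (auto simp: convergent_def)
  qed
  define u where "u x = lim (\<lambda>n. f n x)" for x
  have u[measurable]: "u \<in> borel_measurable M"
    unfolding u_def using meas by (intro borel_measurable_lim_metric)
  have lim: "AE x in M. (\<lambda>n. f n x) \<longlonglongrightarrow> u x"
    using conv by eventually_elim (simp add: u_def convergent_LIMSEQ_iff)
  \<comment> \<open>Fatou in the second index, with the first one fixed, turns the Cauchy bound into
    a bound on the distance to the limit.\<close>
  have F: "integrable M (\<lambda>x. (f n x - u x)\<^sup>2) \<and> (\<integral>x. (f n x - u x)\<^sup>2 \<partial>M) \<le> K * (1/16)^n" for n
  proof -
    have l: "AE x in M. (\<lambda>m. (f n x - f (n + m) x)\<^sup>2) \<longlonglongrightarrow> (f n x - u x)\<^sup>2"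
      using lim by eventually_elim
        (intro tendsto_intros, subst add.commute, rule LIMSEQ_ignore_initial_segment)
    note Fatou_integral_le[OF _ _ _ l, of "K * (1/16)^n"]
    then show ?thesis using int bound[of n] meas u by auto
  qed
  have l0: "(\<lambda>n. K * (1/16)^n) \<longlonglongrightarrow> 0"
    by (auto intro!: tendsto_mult_right_zero LIMSEQ_power_zero)
  have "(\<lambda>n. \<integral>x. (f n x - u x)\<^sup>2 \<partial>M) \<longlonglongrightarrow> 0"
    by (rule tendsto_sandwich[OF _ _ tendsto_const l0]) (use F in auto)
  with that u lim F show thesis by blast
qed

section \<open>Convexity of the exponential term\<close>

text \<open>Tangent line inequality for the function named \<open>energy_density\<close> below,
  whose derivative is \<open>exp (2 * t) - 1\<close>. It is \<open>1 + s \<le> exp s\<close> at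
  \<open>s = 2 * a - 2 * b\<close>, multiplied by \<open>exp (2 * b)\<close>.\<close>

lemma exp_convex_gradient: "(exp (2 * b) - 1) * (a - b) \<le> (exp (2 * a) - 1 - 2 * a) / 2 - (exp (2 * b) - 1 - 2 * b) / (2::real)"
proof -
  have "exp (2 * b) * (1 + (2 * a - 2 * b)) \<le> exp (2 * b) * exp (2 * a - 2 * b)"
    by (intro mult_left_mono exp_ge_add_one_self) auto
  also have "\<dots> = exp (2 * a)" by (simp add: exp_add[symmetric])
  finally show ?thesis by (simp add: field_simps)
qed


text \<open>Subtracting the affine part \<open>1 + 2 * t\<close> makes the density vanish at 0, so
  that it is integrable against \<open>w\<close> for compactly supported functions, and makes it
  nonnegative. The subtracted slope is compensated by \<open>h = Q1 - Q2\<close> in the linear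
  term.\<close>

definition energy_density :: "real \<Rightarrow> real"
  where "energy_density t = (exp (2 * t) - 1 - 2 * t) / 2"

lemma energy_density_nonneg: "0 \<le> energy_density t"
  using exp_convex_gradient[of 0 t] by (simp add: energy_density_def)

lemma continuous_on_energy_density: "continuous_on UNIV energy_density"
  unfolding energy_density_def by (intro continuous_intros) auto

lemma mult_exp_minus_one_nonneg: "0 \<le> t * (exp (2 * t) - 1)" for t :: real
  by (cases "0 \<le> t") (auto intro: mult_nonneg_nonneg mult_nonpos_nonpos)

section \<open>The abstract variational problem\<close>

text \<open>\<open>T\<close> stands for the test functions; no completeness is assumed.
  \<open>w_local\<close> expresses local integrability of \<open>w\<close> without a topology on the
  domain. Coercivity is asked in \<open>L^2\<close> only: the stronger \<open>H^k\<close> Cauchy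
  property is read off later from the quadratic form of \<open>P\<close>.\<close>

locale coercive_problem =
  fixes M :: "'a measure" and T :: "('a \<Rightarrow> real) set" and P :: "('a \<Rightarrow> real) \<Rightarrow> 'a \<Rightarrow> real"
    and h w :: "'a \<Rightarrow> real" and c :: real
  assumes T_zero: "(\<lambda>x. 0) \<in> T"
    and T_add: "\<phi> \<in> T \<Longrightarrow> \<psi> \<in> T \<Longrightarrow> (\<lambda>x. \<phi> x + \<psi> x) \<in> T"
    and T_scale: "\<phi> \<in> T \<Longrightarrow> (\<lambda>x. r * \<phi> x) \<in> T"
    and T_measurable: "\<phi> \<in> T \<Longrightarrow> \<phi> \<in> borel_measurable M"
    and T_bounded: "\<phi> \<in> T \<Longrightarrow> \<exists>C. \<forall>x. \<bar>\<phi> x\<bar> \<le> C"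
    and T_L2: "\<phi> \<in> T \<Longrightarrow> integrable M (\<lambda>x. (\<phi> x)\<^sup>2)"
    and P_T: "\<phi> \<in> T \<Longrightarrow> P \<phi> \<in> T"
    and P_add: "\<phi> \<in> T \<Longrightarrow> \<psi> \<in> T \<Longrightarrow> P (\<lambda>x. \<phi> x + \<psi> x) = (\<lambda>x. P \<phi> x + P \<psi> x)"
    and P_scale: "\<phi> \<in> T \<Longrightarrow> P (\<lambda>x. r * \<phi> x) = (\<lambda>x. r * P \<phi> x)"
    and P_sym: "\<phi> \<in> T \<Longrightarrow> \<psi> \<in> T \<Longrightarrow> (\<integral>x. \<phi> x * P \<psi> x \<partial>M) = (\<integral>x. \<psi> x * P \<phi> x \<partial>M)"
    and c_pos: "0 < c"
    and P_coercive: "\<phi> \<in> T \<Longrightarrow> c * (\<integral>x. (\<phi> x)\<^sup>2 \<partial>M) \<le> (\<integral>x. \<phi> x * P \<phi> x \<partial>M)"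
    and h_measurable: "h \<in> borel_measurable M"
    and h_L2: "integrable M (\<lambda>x. (h x)\<^sup>2)"
    and w_measurable: "w \<in> borel_measurable M"
    and w_nonneg: "0 \<le> w x"
    and w_local: "\<phi> \<in> T \<Longrightarrow> integrable M (\<lambda>x. w x * indicator {x. \<phi> x \<noteq> 0} x)"
begin

definition B where "B \<phi> \<psi> = (\<integral>x. \<phi> x * P \<psi> x \<partial>M)"

definition energy where
  "energy \<phi> = B \<phi> \<phi> / 2 + (\<integral>x. h x * \<phi> x \<partial>M) + (\<integral>x. w x * energy_density (\<phi> x) \<partial>M)"

text \<open>The directional derivative of \<open>energy\<close> at \<open>\<phi>\<close> along
  \<open>v\<close>; by symmetry of \<open>B\<close> the quadratic part contributes the single term
  \<open>B \<phi> v\<close>. Its relation to \<open>energy\<close> is used only through the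
  inequality \<open>energy_gradient\<close>, so no limit of difference quotients is taken.\<close>

definition energy_deriv where
  "energy_deriv \<phi> v = B \<phi> v + (\<integral>x. h x * v x \<partial>M) + (\<integral>x. w x * ((exp (2 * \<phi> x) - 1) * v x) \<partial>M)"

lemma T_diff: "\<phi> \<in> T \<Longrightarrow> \<psi> \<in> T \<Longrightarrow> (\<lambda>x. \<phi> x - \<psi> x) \<in> T"
  using T_add[OF _ T_scale[of \<psi> "-1"], of \<phi>] by simp

lemma T_mult_integrable: "\<phi> \<in> T \<Longrightarrow> \<psi> \<in> T \<Longrightarrow> integrable M (\<lambda>x. \<phi> x * \<psi> x)"
  by (intro integrable_mult_L2 T_measurable T_L2)

lemma h_mult_integrable: "\<phi> \<in> T \<Longrightarrow> integrable M (\<lambda>x. h x * \<phi> x)"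
  by (intro integrable_mult_L2 T_measurable T_L2 h_measurable h_L2)

lemma B_add_left: "\<phi> \<in> T \<Longrightarrow> \<psi> \<in> T \<Longrightarrow> \<theta> \<in> T \<Longrightarrow> B (\<lambda>x. \<phi> x + \<psi> x) \<theta> = B \<phi> \<theta> + B \<psi> \<theta>"
  by (simp add: B_def distrib_right T_mult_integrable P_T)

lemma B_scale_left: "\<phi> \<in> T \<Longrightarrow> \<theta> \<in> T \<Longrightarrow> B (\<lambda>x. r * \<phi> x) \<theta> = r * B \<phi> \<theta>"
  by (simp add: B_def mult.assoc T_mult_integrable P_T)

lemma B_sym: "\<phi> \<in> T \<Longrightarrow> \<psi> \<in> T \<Longrightarrow> B \<phi> \<psi> = B \<psi> \<phi>"
  unfolding B_def by (rule P_sym)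

lemma B_scale_right: "\<phi> \<in> T \<Longrightarrow> \<theta> \<in> T \<Longrightarrow> B \<theta> (\<lambda>x. r * \<phi> x) = r * B \<theta> \<phi>"
  by (simp add: B_sym[of \<theta>] T_scale B_scale_left)

lemma B_diff_left: "\<phi> \<in> T \<Longrightarrow> \<psi> \<in> T \<Longrightarrow> \<theta> \<in> T \<Longrightarrow> B (\<lambda>x. \<phi> x - \<psi> x) \<theta> = B \<phi> \<theta> - B \<psi> \<theta>"
  using B_add_left[OF _ T_scale[of \<psi> "-1"], of \<phi> \<theta>] by (simp add: B_scale_left[of \<psi> \<theta> "-1", simplified])

lemma B_diff_right: "\<phi> \<in> T \<Longrightarrow> \<psi> \<in> T \<Longrightarrow> \<theta> \<in> T \<Longrightarrow> B \<theta> (\<lambda>x. \<phi> x - \<psi> x) = B \<theta> \<phi> - B \<theta> \<psi>"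
  by (simp add: B_sym[of \<theta>] T_diff B_diff_left)

lemma B_coercive: "\<phi> \<in> T \<Longrightarrow> c * (\<integral>x. (\<phi> x)\<^sup>2 \<partial>M) \<le> B \<phi> \<phi>"
  unfolding B_def by (rule P_coercive)

lemma B_nonneg: "\<phi> \<in> T \<Longrightarrow> 0 \<le> B \<phi> \<phi>"
  using B_coercive[of \<phi>] c_pos by (smt (verit) mult_nonneg_nonneg Bochner_Integration.integral_nonneg zero_le_power2)

lemma w_mult_integrable:
  assumes "\<phi> \<in> T" "\<xi> \<in> borel_measurable M" "\<And>x. \<bar>\<xi> x\<bar> \<le> C" "\<And>x. \<phi> x = 0 \<Longrightarrow> \<xi> x = 0"
  shows "integrable M (\<lambda>x. w x * \<xi> x)"
proof (rule Bochner_Integration.integrable_bound)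
  show "integrable M (\<lambda>x. C * (w x * indicator {x. \<phi> x \<noteq> 0} x))"
    using w_local[OF assms(1)] by simp
  have "w x * \<bar>\<xi> x\<bar> \<le> \<bar>C\<bar> * (w x * indicator {x. \<phi> x \<noteq> 0} x)" for x
    using mult_left_mono[OF assms(3)[of x] w_nonneg[of x]] assms(3,4)[of x] w_nonneg[of x]
    by (auto simp: indicator_def mult.commute)
  then show "AE x in M. norm (w x * \<xi> x) \<le> norm (C * (w x * indicator {x. \<phi> x \<noteq> 0} x))"
    using w_nonneg by (auto simp: abs_mult)
qed (use assms w_measurable in auto)

lemma continuous_comp_bounded:
  fixes g :: "real \<Rightarrow> real"
  assumes "continuous_on UNIV g" "\<phi> \<in> T"
  obtains C where "\<And>x. \<bar>g (\<phi> x)\<bar> \<le> C"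
proof -
  obtain D where D: "\<And>x. \<bar>\<phi> x\<bar> \<le> D" using T_bounded[OF assms(2)] by blast
  have "compact (g ` {-D..D})"
    using assms(1) by (intro compact_continuous_image) (auto intro: continuous_on_subset)
  then obtain C where "\<And>t. t \<in> {-D..D} \<Longrightarrow> \<bar>g t\<bar> \<le> C"
    by (force dest!: compact_imp_bounded simp: bounded_iff)
  then show thesis using D by (intro that[of C]) (auto simp: abs_le_iff minus_le_iff)
qed

lemma w_comp_integrable:
  fixes g :: "real \<Rightarrow> real"
  assumes "continuous_on UNIV g" "g 0 = 0" "\<phi> \<in> T"
  shows "integrable M (\<lambda>x. w x * g (\<phi> x))"
proof -
  obtain C where "\<And>x. \<bar>g (\<phi> x)\<bar> \<le> C" using continuous_comp_bounded[OF assms(1,3)] by blast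
  then show ?thesis
    using borel_measurable_continuous_on[OF assms(1) T_measurable[OF assms(3)]] assms
    by (intro w_mult_integrable[OF assms(3)]) auto
qed

lemma w_density_integrable: "\<phi> \<in> T \<Longrightarrow> integrable M (\<lambda>x. w x * energy_density (\<phi> x))"
  by (rule w_comp_integrable[OF continuous_on_energy_density]) (auto simp: energy_density_def)

lemma w_deriv_integrable:
  fixes g :: "real \<Rightarrow> real"
  assumes g: "continuous_on UNIV g" and "\<phi> \<in> T" "v \<in> T"
  shows "integrable M (\<lambda>x. w x * (g (\<phi> x) * v x))"
proof -
  obtain C D where C: "\<And>x. \<bar>g (\<phi> x)\<bar> \<le> C" and D: "\<And>x. \<bar>v x\<bar> \<le> D"
    using continuous_comp_bounded[OF g assms(2)] T_bounded[OF assms(3)] by metis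
  have "\<bar>g (\<phi> x) * v x\<bar> \<le> C * D" for x
    unfolding abs_mult using C[of x] D[of x] by (intro mult_mono) auto
  then show ?thesis
    using borel_measurable_continuous_on[OF g T_measurable[OF assms(2)]] T_measurable[OF assms(3)]
    by (intro w_mult_integrable[OF assms(3)]) auto
qed

lemma w_exp_integrable: "\<phi> \<in> T \<Longrightarrow> v \<in> T \<Longrightarrow> integrable M (\<lambda>x. w x * ((exp (2 * \<phi> x) - 1) * v x))"
  by (rule w_deriv_integrable) (intro continuous_intros)

lemma energy_deriv_scale:
  assumes "\<phi> \<in> T" "v \<in> T"
  shows "energy_deriv \<phi> (\<lambda>x. r * v x) = r * energy_deriv \<phi> v"
proof -
  have "(\<lambda>x. w x * ((exp (2 * \<phi> x) - 1) * (r * v x))) = (\<lambda>x. r * (w x * ((exp (2 * \<phi> x) - 1) * v x)))"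
    "(\<lambda>x. h x * (r * v x)) = (\<lambda>x. r * (h x * v x))" by (auto simp: algebra_simps)
  with assms show ?thesis
    unfolding energy_deriv_def by (simp add: B_scale_right distrib_left)
qed

text \<open>Strong convexity in first-order form. The quadratic part expands exactly and leaves half
  the form of the difference, the linear part is exact, and the exponential part obeys the tangent
  line inequality. All statements on near-minimisers follow from this one.\<close>

lemma energy_gradient:
  assumes "\<phi> \<in> T" "\<psi> \<in> T"
  shows "energy \<psi> + energy_deriv \<psi> (\<lambda>x. \<phi> x - \<psi> x) + B (\<lambda>x. \<phi> x - \<psi> x) (\<lambda>x. \<phi> x - \<psi> x) / 2 \<le> energy \<phi>"
proof -
  note [simp] = T_diff assms B_diff_left B_diff_right h_mult_integrable w_density_integrable w_exp_integrable
  have "(\<integral>x. w x * ((exp (2 * \<psi> x) - 1) * (\<phi> x - \<psi> x)) \<partial>M) \<le>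
      (\<integral>x. w x * energy_density (\<phi> x) - w x * energy_density (\<psi> x) \<partial>M)"
  proof (rule integral_mono)
    show "integrable M (\<lambda>x. w x * ((exp (2 * \<psi> x) - 1) * (\<phi> x - \<psi> x)))"
      by (rule w_exp_integrable) auto
    show "w x * ((exp (2 * \<psi> x) - 1) * (\<phi> x - \<psi> x)) \<le>
        w x * energy_density (\<phi> x) - w x * energy_density (\<psi> x)" for x
      using mult_left_mono[OF exp_convex_gradient[of "\<psi> x" "\<phi> x"] w_nonneg[of x]]
      by (simp add: energy_density_def algebra_simps)
  qed simp
  moreover have "(\<integral>x. h x * (\<phi> x - \<psi> x) \<partial>M) = (\<integral>x. h x * \<phi> x \<partial>M) - (\<integral>x. h x * \<psi> x \<partial>M)"
    by (simp add: right_diff_distrib)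
  ultimately show ?thesis
    using B_sym[OF assms] by (simp add: energy_def energy_deriv_def add_divide_distrib diff_divide_distrib)
qed

text \<open>Young's inequality is weighted so that the linear term consumes \<open>c / 4\<close> of
  the \<open>c / 2\<close> supplied by coercivity; the exponential term is nonnegative. The same
  estimate bounds the energy from below.\<close>

lemma L2_bound_by_energy:
  assumes "\<phi> \<in> T"
  shows "c / 4 * (\<integral>x. (\<phi> x)\<^sup>2 \<partial>M) \<le> energy \<phi> + (\<integral>x. (h x)\<^sup>2 \<partial>M) / c"
proof -
  have "h x * \<phi> x \<ge> - ((h x)\<^sup>2 / c + c / 4 * (\<phi> x)\<^sup>2)" for x
    using zero_le_power2[of "h x / sqrt c + sqrt c / 2 * \<phi> x"] c_pos
    by (simp add: power2_sum power_divide power_mult_distrib)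
  then have "(\<integral>x. - ((h x)\<^sup>2 / c + c / 4 * (\<phi> x)\<^sup>2) \<partial>M) \<le> (\<integral>x. h x * \<phi> x \<partial>M)"
    using assms h_L2 by (intro integral_mono) (auto simp: T_L2 h_mult_integrable)
  moreover have "0 \<le> (\<integral>x. w x * energy_density (\<phi> x) \<partial>M)"
    by (intro Bochner_Integration.integral_nonneg) (simp add: w_nonneg energy_density_nonneg)
  ultimately show ?thesis
    using B_coercive[OF assms] assms h_L2 by (simp add: energy_def T_L2 field_simps)
qed

section \<open>Infimum of the energy and near-minimisers\<close>

definition inf_energy where "inf_energy = Inf (energy ` T)"

lemma inf_energy_le: "\<phi> \<in> T \<Longrightarrow> inf_energy \<le> energy \<phi>"
  unfolding inf_energy_def
proof (rule cInf_lower)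
  have "- ((\<integral>x. (h x)\<^sup>2 \<partial>M) / c) \<le> energy \<phi>" if "\<phi> \<in> T" for \<phi>
  proof -
    have "0 \<le> c / 4 * (\<integral>x. (\<phi> x)\<^sup>2 \<partial>M)" using c_pos by simp
    with L2_bound_by_energy[OF that] show ?thesis by linarith
  qed
  then show "bdd_below (energy ` T)" by (intro bdd_belowI2)
qed auto

lemma energy_zero: "energy (\<lambda>x. 0) = 0"
  by (simp add: energy_def B_def energy_density_def)

text \<open>The gradient inequality is applied at the midpoint \<open>m\<close>, towards both
  functions. The two derivative terms are opposite and cancel on adding, \<open>energy m\<close> is
  at least the infimum, and each half-distance contributes one eighth of the form of the
  difference.\<close>

lemma near_minimizers_close:
  assumes "\<phi> \<in> T" "\<psi> \<in> T" "energy \<phi> \<le> inf_energy + e" "energy \<psi> \<le> inf_energy + e"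
  shows "B (\<lambda>x. \<phi> x - \<psi> x) (\<lambda>x. \<phi> x - \<psi> x) \<le> 8 * e"
proof -
  define m where "m = (\<lambda>x. (1/2) * (\<phi> x + \<psi> x))"
  define d where "d = (\<lambda>x. \<phi> x - \<psi> x)"
  have m: "m \<in> T" and d: "d \<in> T"
    unfolding m_def d_def by (intro T_scale T_add T_diff assms)+
  have eq: "(\<lambda>x. \<phi> x - m x) = (\<lambda>x. (1/2) * d x)" "(\<lambda>x. \<psi> x - m x) = (\<lambda>x. (-1/2) * d x)"
    by (auto simp: m_def d_def field_simps)
  have B_d: "B (\<lambda>x. r * d x) (\<lambda>x. r * d x) = r * (r * B d d)" for r
    by (simp only: B_scale_left B_scale_right T_scale d)
  have "energy m + 1/2 * energy_deriv m d + (1/8) * B d d \<le> energy \<phi>"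
    using energy_gradient[OF assms(1) m] unfolding eq energy_deriv_scale[OF m d] B_d by simp
  moreover have "energy m - 1/2 * energy_deriv m d + (1/8) * B d d \<le> energy \<psi>"
    using energy_gradient[OF assms(2) m] unfolding eq energy_deriv_scale[OF m d] B_d by simp
  ultimately show ?thesis
    using inf_energy_le[OF m] assms(3,4) unfolding d_def[symmetric] by linarith
qed

text \<open>Two comparisons are made from \<open>\<psi>\<close>, with \<open>\<phi>\<close> and with
  the zero function. The first bounds the derivative, since the energy drops by at most
  \<open>e\<close> over a step of relative size \<open>e\<close>. Both together show that shrinking
  costs only a multiple of \<open>e\<close> in energy.\<close>

lemma shrink_minimizer:
  assumes "\<phi> \<in> T" "energy \<phi> \<le> inf_energy + e" "0 < e" "e < 1"
  defines "\<psi> \<equiv> (\<lambda>x. (1 - e) * \<phi> x)"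
  shows "energy \<psi> \<le> inf_energy + (1 - inf_energy) * e" and "energy_deriv \<psi> \<psi> \<le> 1"
proof -
  have \<psi>: "\<psi> \<in> T" unfolding \<psi>_def by (rule T_scale[OF assms(1)])
  define D where "D = energy_deriv \<psi> \<phi>"
  have eq: "(\<lambda>x. \<phi> x - \<psi> x) = (\<lambda>x. e * \<phi> x)" "(\<lambda>x. 0 - \<psi> x) = (\<lambda>x. (e - 1) * \<phi> x)"
    by (auto simp: \<psi>_def algebra_simps)
  have 1: "energy \<psi> + e * D \<le> energy \<phi>"
    using energy_gradient[OF assms(1) \<psi>] B_nonneg[OF T_diff[OF assms(1) \<psi>]]
    unfolding eq energy_deriv_scale[OF \<psi> assms(1)] D_def by simp
  have 2: "energy \<psi> + (e - 1) * D \<le> 0"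
    using energy_gradient[OF T_zero \<psi>] B_nonneg[OF T_diff[OF T_zero \<psi>]]
    unfolding eq energy_deriv_scale[OF \<psi> assms(1)] D_def by (simp add: energy_zero)
  \<comment> \<open>\<open>\<psi>\<close> is the convex combination of \<open>\<phi>\<close> and 0
    with weights \<open>1 - e\<close> and \<open>e\<close>; with these weights the derivative
    \<open>D\<close> cancels.\<close>
  have "(1 - e) * (energy \<psi> + e * D) + e * (energy \<psi> + (e - 1) * D) \<le> (1 - e) * (inf_energy + e) + e * 0"
    using assms(3,4)
    by (intro add_mono mult_left_mono[OF order_trans[OF 1 assms(2)]] mult_left_mono[OF 2]) simp_all
  moreover have "(1 - e) * (inf_energy + e) \<le> inf_energy + (1 - inf_energy) * e"
    by (simp add: algebra_simps)
  moreover have "(1 - e) * (energy \<psi> + e * D) + e * (energy \<psi> + (e - 1) * D) = energy \<psi>"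
    by (simp add: algebra_simps)
  ultimately show "energy \<psi> \<le> inf_energy + (1 - inf_energy) * e"
    by linarith
  have "e * D \<le> e * 1" using 1 inf_energy_le[OF \<psi>] assms(2) by linarith
  then have "D \<le> 1" using assms(3) by (simp only: mult_le_cancel_left_pos)
  then have "(1 - e) * D \<le> 1" using assms(3,4) by (smt (verit) mult_left_le)
  then show "energy_deriv \<psi> \<psi> \<le> 1"
    using energy_deriv_scale[OF \<psi> assms(1), of "1 - e"] unfolding D_def \<psi>_def by simp
qed

text \<open>By convexity the increment is controlled by the derivative at the far end of the
  segment, without a Taylor remainder. This is why the derivative at the perturbed point appears in
  the passage to the limit.\<close>

lemma energy_le_of_deriv:
  assumes "\<psi> \<in> T" "v \<in> T" "0 < s"
  shows "energy (\<lambda>x. \<psi> x + s * v x) \<le> energy \<psi> + s * energy_deriv (\<lambda>x. \<psi> x + s * v x) v"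
proof -
  define \<phi> where "\<phi> = (\<lambda>x. \<psi> x + s * v x)"
  have \<phi>: "\<phi> \<in> T" unfolding \<phi>_def by (intro T_add T_scale assms)
  have eq: "(\<lambda>x. \<psi> x - \<phi> x) = (\<lambda>x. (- s) * v x)" by (auto simp: \<phi>_def)
  have "energy \<phi> + energy_deriv \<phi> (\<lambda>x. \<psi> x - \<phi> x) \<le> energy \<psi>"
    using energy_gradient[OF assms(1) \<phi>] B_nonneg[OF T_diff[OF assms(1) \<phi>]] by linarith
  then show ?thesis
    unfolding eq energy_deriv_scale[OF \<phi> assms(2)] unfolding \<phi>_def by simp
qed

text \<open>The bound on \<open>w \<psi> (exp (2 \<psi>) - 1)\<close> makes \<open>w exp (2 \<psi>)\<close> uniformly integrable on the support of
  each \<open>v \<in> T\<close>: its part above height \<open>R\<close> has mass at most \<open>K / R\<close>.\<close>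

lemma exp_integral_tendsto:
  assumes \<psi>: "\<And>n. \<psi> n \<in> T" and v: "v \<in> T"
    and u: "u \<in> borel_measurable M" "AE x in M. (\<lambda>n. \<psi> n x) \<longlonglongrightarrow> u x"
    and K: "\<And>n. (\<integral>x. w x * (\<psi> n x * (exp (2 * \<psi> n x) - 1)) \<partial>M) \<le> K"
    and \<xi>: "\<And>n. \<xi> n \<in> borel_measurable M" "\<And>n x. \<bar>\<xi> n x\<bar> \<le> C" "\<And>n x. v x = 0 \<Longrightarrow> \<xi> n x = 0"
    and \<xi>': "\<xi>' \<in> borel_measurable M" "\<And>x. (\<lambda>n. \<xi> n x) \<longlonglongrightarrow> \<xi>' x"
  shows "integrable M (\<lambda>x. w x * (exp (2 * u x) * \<xi>' x))"
    and "(\<lambda>n. \<integral>x. w x * (exp (2 * \<psi> n x) * \<xi> n x) \<partial>M) \<longlonglongrightarrow> (\<integral>x. w x * (exp (2 * u x) * \<xi>' x) \<partial>M)"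
proof -
  define g where "g t = t * (exp (2 * t) - 1)" for t :: real
  have g_cont: "continuous_on UNIV g" unfolding g_def by (intro continuous_intros)
  have g0: "0 \<le> g t" for t unfolding g_def by (rule mult_exp_minus_one_nonneg)
  note [measurable] = u(1) \<xi>(1) \<xi>'(1) w_measurable T_measurable[OF \<psi>] T_measurable[OF v]
  have [measurable]: "g \<in> borel_measurable borel" using g_cont by (rule borel_measurable_continuous_onI)
  have C0: "0 \<le> C" using \<xi>(2)[of 0 undefined] by linarith
  have \<xi>'_le: "\<bar>\<xi>' x\<bar> \<le> C" for x
    by (rule LIMSEQ_le_const2[OF tendsto_rabs[OF \<xi>'(2)]]) (use \<xi>(2) in auto)
  have \<xi>'_0: "\<xi>' x = 0" if "v x = 0" for x
    using \<xi>'(2)[of x] \<xi>(3)[OF that] by (simp add: LIMSEQ_const_iff)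
  have g_int: "integrable M (\<lambda>x. w x * g (\<psi> n x))" for n
    by (rule w_comp_integrable[OF g_cont _ \<psi>]) (simp add: g_def)
  have lim_g: "AE x in M. (\<lambda>n. w x * g (\<psi> n x)) \<longlonglongrightarrow> w x * g (u x)"
    using u(2) unfolding g_def by eventually_elim (intro tendsto_intros)
  have gu_meas: "(\<lambda>x. w x * g (u x)) \<in> borel_measurable M" by measurable
  \<comment> \<open>Fatou carries the bound \<open>K\<close> over to \<open>u\<close>, so that the
    tail estimate applies to the limit as well as to the sequence.\<close>
  have gu: "integrable M (\<lambda>x. w x * g (u x))" "(\<integral>x. w x * g (u x) \<partial>M) \<le> K"
    using Fatou_integral_le[OF g_int _ gu_meas lim_g, of K] K w_nonneg g0
    by (auto simp: g_def)
  \<comment> \<open>With the exponent cut off at height \<open>R\<close>, the integrand is dominated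
    by a multiple of \<open>w\<close> on the set where \<open>v\<close> is nonzero, and dominated
    convergence applies.\<close>
  have exp_trunc_le: "w x * (exp (2 * min t R) * \<bar>s\<bar>) \<le> \<bar>C * exp (2 * R) * (w x * indicator {x. v x \<noteq> 0} x)\<bar>"
    if "\<bar>s\<bar> \<le> C" "v x = 0 \<Longrightarrow> s = 0" for x s t R
  proof -
    have "exp (2 * min t R) * \<bar>s\<bar> \<le> exp (2 * R) * C"
      using that C0 by (intro mult_mono) auto
    from mult_left_mono[OF this w_nonneg[of x]] show ?thesis
      using that(2) C0 w_nonneg by (auto simp: indicator_def mult_ac abs_mult)
  qed
  have dom_int: "integrable M (\<lambda>x. C * exp (2 * R) * (w x * indicator {x. v x \<noteq> 0} x))" for R
    using w_local[OF v] by simp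
  have trunc_int: "integrable M (\<lambda>x. w x * (exp (2 * min (f x) R) * s x))"
    if [measurable]: "f \<in> borel_measurable M" "s \<in> borel_measurable M" and s: "\<And>x. \<bar>s x\<bar> \<le> C" "\<And>x. v x = 0 \<Longrightarrow> s x = 0"
    for f s R
  proof (rule Bochner_Integration.integrable_bound[OF dom_int[of R]])
    show "AE x in M. norm (w x * (exp (2 * min (f x) R) * s x)) \<le>
        norm (C * exp (2 * R) * (w x * indicator {x. v x \<noteq> 0} x))"
      using exp_trunc_le[OF s] w_nonneg by (intro AE_I2) (simp add: abs_mult)
  qed measurable
  have tail: "\<bar>w x * (exp (2 * t) * s) - w x * (exp (2 * min t R) * s)\<bar> \<le> C / R * (w x * g t)"
    if "\<bar>s\<bar> \<le> C" "0 < R" for x s t R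
  proof -
    have "R * \<bar>exp (2 * t) - exp (2 * min t R)\<bar> \<le> g t"
    proof (cases "t \<le> R")
      case True
      then show ?thesis using g0 by (simp add: min_def)
    next
      case False
      \<comment> \<open>Above height \<open>R\<close> the factor \<open>t\<close> exceeds
        \<open>R\<close>, and \<open>exp (2 * R)\<close> is at least 1.\<close>
      have "R * (exp (2 * t) - exp (2 * R)) \<le> t * (exp (2 * t) - 1)"
        using False that(2) by (intro mult_mono) auto
      with False show ?thesis by (simp add: min_def g_def)
    qed
    then have "\<bar>exp (2 * t) - exp (2 * min t R)\<bar> \<le> g t / R"
      using that(2) by (simp add: field_simps)
    then have "\<bar>s\<bar> * \<bar>exp (2 * t) - exp (2 * min t R)\<bar> \<le> C * (g t / R)"
      using that(1) by (intro mult_mono) auto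
    from mult_left_mono[OF this w_nonneg[of x]] show ?thesis
      using w_nonneg[of x] by (simp add: abs_mult right_diff_distrib[symmetric] left_diff_distrib[symmetric] mult_ac)
  qed
  have tail_int: "integrable M (\<lambda>x. w x * (exp (2 * f x) * s x))"
      "\<bar>(\<integral>x. w x * (exp (2 * f x) * s x) \<partial>M) - (\<integral>x. w x * (exp (2 * min (f x) R) * s x) \<partial>M)\<bar> \<le> C / R * K"
    if [measurable]: "f \<in> borel_measurable M" "s \<in> borel_measurable M" and s: "\<And>x. \<bar>s x\<bar> \<le> C" "\<And>x. v x = 0 \<Longrightarrow> s x = 0"
      and R: "0 < R" and gf: "integrable M (\<lambda>x. w x * g (f x))" "(\<integral>x. w x * g (f x) \<partial>M) \<le> K"
    for f s R
  proof -
    have ti: "integrable M (\<lambda>x. w x * (exp (2 * min (f x) R) * s x))"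
      by (rule trunc_int) (use s in auto)
    have gi: "integrable M (\<lambda>x. C / R * (w x * g (f x)))" using gf by simp
    have "integrable M (\<lambda>x. w x * (exp (2 * f x) * s x) - w x * (exp (2 * min (f x) R) * s x))"
    proof (rule Bochner_Integration.integrable_bound[OF gi])
      show "AE x in M. norm (w x * (exp (2 * f x) * s x) - w x * (exp (2 * min (f x) R) * s x))
          \<le> norm (C / R * (w x * g (f x)))"
        unfolding real_norm_def
        by (intro AE_I2 order_trans[OF tail[OF s(1) R] abs_ge_self])
    qed measurable
    from Bochner_Integration.integrable_add[OF this ti]
    show int: "integrable M (\<lambda>x. w x * (exp (2 * f x) * s x))" by simp
    have "\<bar>(\<integral>x. w x * (exp (2 * f x) * s x) \<partial>M) - (\<integral>x. w x * (exp (2 * min (f x) R) * s x) \<partial>M)\<bar>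
        \<le> (\<integral>x. C / R * (w x * g (f x)) \<partial>M)"
      by (rule integral_abs_diff_le[OF int ti gi]) (rule tail[OF s(1) R])
    also have "\<dots> \<le> C / R * K"
      using gf(2) C0 R by (simp add: mult_left_mono divide_right_mono)
    finally show "\<bar>(\<integral>x. w x * (exp (2 * f x) * s x) \<partial>M) - (\<integral>x. w x * (exp (2 * min (f x) R) * s x) \<partial>M)\<bar> \<le> C / R * K" .
  qed
  have tail_u: "\<bar>(\<integral>x. w x * (exp (2 * u x) * \<xi>' x) \<partial>M) - (\<integral>x. w x * (exp (2 * min (u x) R) * \<xi>' x) \<partial>M)\<bar> \<le> C / R * K"
    if "0 < R" for R
    by (rule tail_int(2)) (use that gu \<xi>'_le \<xi>'_0 in auto)
  have tail_\<psi>: "\<bar>(\<integral>x. w x * (exp (2 * \<psi> n x) * \<xi> n x) \<partial>M) - (\<integral>x. w x * (exp (2 * min (\<psi> n x) R) * \<xi> n x) \<partial>M)\<bar> \<le> C / R * K"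
    if "0 < R" for R n
    by (rule tail_int(2)) (use that g_int K \<xi>(2,3) in \<open>auto simp: g_def\<close>)
  show "integrable M (\<lambda>x. w x * (exp (2 * u x) * \<xi>' x))"
    by (rule tail_int(1)[of _ _ 1]) (use gu \<xi>'_le \<xi>'_0 in auto)
  have trunc_lim: "(\<lambda>n. \<integral>x. w x * (exp (2 * min (\<psi> n x) R) * \<xi> n x) \<partial>M) \<longlonglongrightarrow>
      (\<integral>x. w x * (exp (2 * min (u x) R) * \<xi>' x) \<partial>M)" for R
  proof (rule integral_dominated_convergence[where w="\<lambda>x. \<bar>C * exp (2 * R) * (w x * indicator {x. v x \<noteq> 0} x)\<bar>"])
    show "AE x in M. (\<lambda>n. w x * (exp (2 * min (\<psi> n x) R) * \<xi> n x)) \<longlonglongrightarrow> w x * (exp (2 * min (u x) R) * \<xi>' x)"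
      using u(2) by eventually_elim (intro tendsto_intros \<xi>'(2))
    show "AE x in M. norm (w x * (exp (2 * min (\<psi> n x) R) * \<xi> n x)) \<le>
        \<bar>C * exp (2 * R) * (w x * indicator {x. v x \<noteq> 0} x)\<bar>" for n
      using exp_trunc_le[OF \<xi>(2,3)] w_nonneg by (intro AE_I2) (simp add: abs_mult)
  qed (use dom_int[THEN integrable_abs] in auto)
  show "(\<lambda>n. \<integral>x. w x * (exp (2 * \<psi> n x) * \<xi> n x) \<partial>M) \<longlonglongrightarrow> (\<integral>x. w x * (exp (2 * u x) * \<xi>' x) \<partial>M)"
  proof (rule LIMSEQ_I)
    fix e :: real assume e: "0 < e"
    \<comment> \<open>Makes each of the two tails at most \<open>e / 4\<close>, which with the
      truncated difference stays below \<open>e\<close>. The summand 1 keeps \<open>R\<close>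
      positive when \<open>C * K\<close> is 0.\<close>
    define R where "R = 1 + \<bar>C * K\<bar> * 4 / e"
    have R: "0 < R" unfolding R_def using e by (intro add_pos_nonneg) auto
    have "C * K \<le> \<bar>C * K\<bar>" by simp
    also have "4 * \<bar>C * K\<bar> \<le> e * R" using e by (simp add: R_def field_simps)
    finally have small: "C / R * K \<le> e / 4" using R by (simp add: field_simps)
    obtain n0 where n0: "\<And>n. n \<ge> n0 \<Longrightarrow> \<bar>(\<integral>x. w x * (exp (2 * min (\<psi> n x) R) * \<xi> n x) \<partial>M) -
      (\<integral>x. w x * (exp (2 * min (u x) R) * \<xi>' x) \<partial>M)\<bar> < e / 4"
      using LIMSEQ_D[OF trunc_lim[of R], of "e / 4"] e by auto
    have "norm ((\<integral>x. w x * (exp (2 * \<psi> n x) * \<xi> n x) \<partial>M) - (\<integral>x. w x * (exp (2 * u x) * \<xi>' x) \<partial>M)) < e"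
      if "n \<ge> n0" for n
      using n0[OF that] tail_\<psi>[OF R, of n] tail_u[OF R] small e unfolding real_norm_def by linarith
    then show "\<exists>no. \<forall>n\<ge>no. norm ((\<integral>x. w x * (exp (2 * \<psi> n x) * \<xi> n x) \<partial>M) - (\<integral>x. w x * (exp (2 * u x) * \<xi>' x) \<partial>M)) < e"
      by blast
  qed
qed

section \<open>Minimising sequence and passage to the limit\<close>

lemma exists_minimizing_sequence:
  obtains \<psi> K where "\<And>n. \<psi> n \<in> T" "\<And>n. energy (\<psi> n) \<le> inf_energy + K * (1/16)^n"
    "\<And>n. energy_deriv (\<psi> n) (\<psi> n) \<le> 1" "0 \<le> K"
proof -
  \<comment> \<open>The exponent starts at 1 because shrinking requires \<open>e n < 1\<close>. The
    ratio \<open>1/16\<close> leaves room for a factor \<open>4^n\<close> both in the almost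
    everywhere convergence and in the perturbation argument.\<close>
  define e where "e n = (1/16::real)^Suc n" for n
  have e: "0 < e n" "e n < 1" "e n \<le> (1/16)^n" for n
    using power_le_one[of "1/16::real" n] unfolding e_def power_Suc by (auto intro: le_less_trans)
  have "\<exists>\<phi>\<in>T. energy \<phi> \<le> inf_energy + e n" for n
  proof (rule ccontr)
    assume "\<not> ?thesis"
    then have "inf_energy + e n \<le> energy \<phi>" if "\<phi> \<in> T" for \<phi> using that by force
    then have "inf_energy + e n \<le> Inf (energy ` T)"
      using T_zero by (intro cINF_greatest) auto
    with e(1)[of n] show False by (simp add: inf_energy_def)
  qed
  then obtain \<phi> where \<phi>: "\<And>n. \<phi> n \<in> T" "\<And>n. energy (\<phi> n) \<le> inf_energy + e n" by metis
  \<comment> \<open>The zero function has energy 0, so the infimum is not positive;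
    \<open>1 - inf_energy\<close> is the cost factor of shrinking.\<close>
  have K: "0 \<le> 1 - inf_energy" using inf_energy_le[OF T_zero] by (simp add: energy_zero)
  show thesis
  proof (rule that[of "\<lambda>n x. (1 - e n) * \<phi> n x" "1 - inf_energy"])
    fix n
    show "(\<lambda>x. (1 - e n) * \<phi> n x) \<in> T" by (rule T_scale[OF \<phi>(1)])
    have "energy (\<lambda>x. (1 - e n) * \<phi> n x) \<le> inf_energy + (1 - inf_energy) * e n"
      by (rule shrink_minimizer[OF \<phi> e(1,2)])
    also have "\<dots> \<le> inf_energy + (1 - inf_energy) * (1/16)^n"
      using K e(3) by (intro add_left_mono mult_left_mono)
    finally show "energy (\<lambda>x. (1 - e n) * \<phi> n x) \<le> inf_energy + (1 - inf_energy) * (1/16)^n" .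
    show "energy_deriv (\<lambda>x. (1 - e n) * \<phi> n x) (\<lambda>x. (1 - e n) * \<phi> n x) \<le> 1"
      by (rule shrink_minimizer[OF \<phi> e(1,2)])
  qed (rule K)
qed

lemma L2_tendsto_inner:
  assumes \<psi>: "\<And>n. \<psi> n \<in> T" and u[measurable]: "u \<in> borel_measurable M"
    and int: "\<And>n. integrable M (\<lambda>x. (\<psi> n x - u x)\<^sup>2)"
    and lim: "(\<lambda>n. \<integral>x. (\<psi> n x - u x)\<^sup>2 \<partial>M) \<longlonglongrightarrow> 0" and v: "v \<in> T"
  shows "integrable M (\<lambda>x. u x * v x)" and "(\<lambda>n. \<integral>x. \<psi> n x * v x \<partial>M) \<longlonglongrightarrow> (\<integral>x. u x * v x \<partial>M)"
proof -
  note [measurable] = T_measurable[OF \<psi>] T_measurable[OF v]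
  have d_int: "integrable M (\<lambda>x. (\<psi> n x - u x) * v x)" for n
    using int T_L2[OF v] by (intro integrable_mult_L2) auto
  have "integrable M (\<lambda>x. \<psi> 0 x * v x - (\<psi> 0 x - u x) * v x)"
    by (intro Bochner_Integration.integrable_diff d_int T_mult_integrable \<psi> v)
  then show uv: "integrable M (\<lambda>x. u x * v x)" by (simp add: algebra_simps)
  define V where "V = (\<integral>x. (v x)\<^sup>2 \<partial>M)"
  define D where "D n = (\<integral>x. (\<psi> n x - u x)\<^sup>2 \<partial>M)" for n
  have V0: "0 \<le> V" and D0: "0 \<le> D n" for n unfolding V_def D_def by auto
  show "(\<lambda>n. \<integral>x. \<psi> n x * v x \<partial>M) \<longlonglongrightarrow> (\<integral>x. u x * v x \<partial>M)"
  proof (rule LIMSEQ_I)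
    fix e :: real assume e: "0 < e"
    \<comment> \<open>The weight in Young's inequality: \<open>V / (2 * r)\<close> is below
      \<open>e / 2\<close> by this choice, and \<open>r / 2 * D n\<close> is below
      \<open>e / 2\<close> once \<open>D n < e / r\<close>. Adding 1 to \<open>V\<close> keeps
      \<open>r\<close> positive.\<close>
    define r where "r = (V + 1) / e"
    have r: "0 < r" using V0 e by (simp add: r_def)
    from LIMSEQ_D[OF lim, of "e / r"] obtain n0 where n0: "\<And>n. n \<ge> n0 \<Longrightarrow> D n < e / r"
      using e r D0 by (auto simp: D_def[symmetric])
    have "\<bar>(\<integral>x. \<psi> n x * v x \<partial>M) - (\<integral>x. u x * v x \<partial>M)\<bar> < e" if "n \<ge> n0" for n
    proof -
      have "\<bar>(\<integral>x. \<psi> n x * v x \<partial>M) - (\<integral>x. u x * v x \<partial>M)\<bar> \<le> (\<integral>x. r / 2 * (\<psi> n x - u x)\<^sup>2 + 1 / (2 * r) * (v x)\<^sup>2 \<partial>M)"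
      proof (rule integral_abs_diff_le[OF T_mult_integrable[OF \<psi> v] uv])
        show "integrable M (\<lambda>x. r / 2 * (\<psi> n x - u x)\<^sup>2 + 1 / (2 * r) * (v x)\<^sup>2)"
          using int T_L2[OF v] by simp
        have "\<bar>a * b\<bar> \<le> r / 2 * a\<^sup>2 + 1 / (2 * r) * b\<^sup>2" for a b :: real
        proof -
          have "0 \<le> (r * \<bar>a\<bar> - \<bar>b\<bar>)\<^sup>2 / (2 * r)" using r by simp
          also have "\<dots> = r / 2 * a\<^sup>2 + 1 / (2 * r) * b\<^sup>2 - \<bar>a * b\<bar>"
            using r by (simp add: power2_diff power_mult_distrib abs_mult field_simps power2_eq_square)
          finally show ?thesis by simp
        qed
        then show "\<bar>\<psi> n x * v x - u x * v x\<bar> \<le> r / 2 * (\<psi> n x - u x)\<^sup>2 + 1 / (2 * r) * (v x)\<^sup>2" for x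
          unfolding left_diff_distrib[symmetric] .
      qed
      also have "\<dots> = r / 2 * D n + V / (2 * r)"
        using int T_L2[OF v] by (simp add: D_def V_def)
      also have "\<dots> < r / 2 * (e / r) + (V + 1) / (2 * r)"
        using n0[OF that] r by (intro add_strict_mono mult_strict_left_mono divide_strict_right_mono) auto
      also have "\<dots> = e" using r e V0 by (simp add: r_def nonzero_divide_eq_eq distrib_left)
      finally show ?thesis .
    qed
    then show "\<exists>no. \<forall>n\<ge>no. norm ((\<integral>x. \<psi> n x * v x \<partial>M) - (\<integral>x. u x * v x \<partial>M)) < e"
      by (auto simp: real_norm_def)
  qed
qed

text \<open>The approximating functions are returned along with \<open>u\<close>: their Cauchy
  property in the form of \<open>P\<close> is what later places \<open>u\<close> in the
  completion.\<close>

theorem weak_solution_exists: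
  obtains u \<psi> where "u \<in> borel_measurable M" "integrable M (\<lambda>x. (u x)\<^sup>2)" "\<And>n. \<psi> n \<in> T"
    "(\<lambda>n. \<integral>x. (\<psi> n x - u x)\<^sup>2 \<partial>M) \<longlonglongrightarrow> 0"
    "\<And>e. e > 0 \<Longrightarrow> \<exists>N. \<forall>m\<ge>N. \<forall>n\<ge>N. (\<integral>x. (\<psi> m x - \<psi> n x) * P (\<lambda>x. \<psi> m x - \<psi> n x) x \<partial>M) < e"
    "\<And>v. v \<in> T \<Longrightarrow> integrable M (\<lambda>x. u x * P v x)"
    "\<And>v. v \<in> T \<Longrightarrow> integrable M (\<lambda>x. (h x + w x * (exp (2 * u x) - 1)) * v x)"
    "\<And>v. v \<in> T \<Longrightarrow> (\<integral>x. u x * P v x \<partial>M) + (\<integral>x. (h x + w x * (exp (2 * u x) - 1)) * v x \<partial>M) = 0"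
proof -
  obtain \<psi> K where \<psi>: "\<And>n. \<psi> n \<in> T" and en: "\<And>n. energy (\<psi> n) \<le> inf_energy + K * (1/16)^n"
    and deriv: "\<And>n. energy_deriv (\<psi> n) (\<psi> n) \<le> 1" and K: "0 \<le> K"
    using exists_minimizing_sequence by blast
  have B_close: "B (\<lambda>x. \<psi> m x - \<psi> n x) (\<lambda>x. \<psi> m x - \<psi> n x) \<le> 8 * (K * (1/16)^i)" if "i \<le> m" "i \<le> n" for m n i
  proof -
    have le: "energy (\<psi> j) \<le> inf_energy + K * (1/16)^i" if "i \<le> j" for j
    proof -
      have "K * (1/16::real)^j \<le> K * (1/16)^i"
        using that K by (intro mult_left_mono power_decreasing) auto
      with en[of j] show ?thesis by linarith
    qed
    show ?thesis by (rule near_minimizers_close[OF \<psi> \<psi> le le]) (use that in auto)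
  qed
  have L2_close: "(\<integral>x. (\<psi> m x - \<psi> n x)\<^sup>2 \<partial>M) \<le> (8 * K / c) * (1/16)^m" if "m \<le> n" for m n
    using order_trans[OF B_coercive[OF T_diff[OF \<psi> \<psi>]] B_close[OF order_refl that]] c_pos
    by (simp add: field_simps)
  obtain u where u: "u \<in> borel_measurable M" "AE x in M. (\<lambda>n. \<psi> n x) \<longlonglongrightarrow> u x"
      "\<And>n. integrable M (\<lambda>x. (\<psi> n x - u x)\<^sup>2)" "(\<lambda>n. \<integral>x. (\<psi> n x - u x)\<^sup>2 \<partial>M) \<longlonglongrightarrow> 0"
    by (rule L2_limit_of_geometric_increments[of \<psi> M, OF T_measurable[OF \<psi>] T_L2[OF T_diff[OF \<psi> \<psi>]] L2_close]) blast+
  note [measurable] = u(1) T_measurable[OF \<psi>] h_measurable w_measurable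
  have u_L2: "integrable M (\<lambda>x. (u x)\<^sup>2)"
  proof (rule Bochner_Integration.integrable_bound)
    show "integrable M (\<lambda>x. 2 * (\<psi> 0 x)\<^sup>2 + 2 * (\<psi> 0 x - u x)\<^sup>2)"
      using T_L2[OF \<psi>] u(3) by simp
    have "b\<^sup>2 \<le> 2 * a\<^sup>2 + 2 * (a - b)\<^sup>2" for a b :: real
      using zero_le_power2[of "2 * a - b"] by (simp add: power2_eq_square algebra_simps)
    then show "AE x in M. norm ((u x)\<^sup>2) \<le> norm (2 * (\<psi> 0 x)\<^sup>2 + 2 * (\<psi> 0 x - u x)\<^sup>2)" by simp
  qed measurable
  define L where "L = 4 / c * (inf_energy + K + (\<integral>x. (h x)\<^sup>2 \<partial>M) / c)"
  have L: "(\<integral>x. (\<psi> n x)\<^sup>2 \<partial>M) \<le> L" for n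
  proof -
    have "energy (\<psi> n) \<le> inf_energy + K"
      using en[of n] K mult_left_mono[OF power_le_one[of "1/16::real" n], of K] by simp
    with L2_bound_by_energy[OF \<psi>[of n]]
    have "c / 4 * (\<integral>x. (\<psi> n x)\<^sup>2 \<partial>M) \<le> inf_energy + K + (\<integral>x. (h x)\<^sup>2 \<partial>M) / c" by linarith
    from mult_left_mono[OF this, of "4 / c"] show ?thesis using c_pos by (simp add: L_def)
  qed
  have exp_bound: "(\<integral>x. w x * (\<psi> n x * (exp (2 * \<psi> n x) - 1)) \<partial>M) \<le> 1 + (\<integral>x. (h x)\<^sup>2 \<partial>M) + L" for n
  proof -
    have "(\<integral>x. - ((h x)\<^sup>2 + (\<psi> n x)\<^sup>2) \<partial>M) \<le> (\<integral>x. h x * \<psi> n x \<partial>M)"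
    proof (rule integral_mono)
      have "- (a\<^sup>2 + b\<^sup>2) \<le> a * b" for a b :: real
        using zero_le_power2[of "a + b"] zero_le_power2[of a] zero_le_power2[of b] unfolding power2_sum by linarith
      then show "- ((h x)\<^sup>2 + (\<psi> n x)\<^sup>2) \<le> h x * \<psi> n x" for x .
    qed (use h_L2 T_L2[OF \<psi>] h_mult_integrable[OF \<psi>] in auto)
    then show ?thesis
      using deriv[of n] B_nonneg[OF \<psi>[of n]] L[of n] h_L2 T_L2[OF \<psi>]
      by (simp add: energy_deriv_def mult.commute[of "\<psi> n x" for x])
  qed
  have exp_int: "integrable M (\<lambda>x. w x * (exp (2 * u x) * v x))" if v: "v \<in> T" for v
  proof -
    obtain C where C: "\<And>x. \<bar>v x\<bar> \<le> C" using T_bounded[OF v] by blast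
    show ?thesis
      by (rule exp_integral_tendsto(1)[OF \<psi> v u(1,2) exp_bound, where \<xi>="\<lambda>n. v" and C=C])
         (use T_measurable[OF v] C in auto)
  qed
  \<comment> \<open>The weak residual of the equation. The parts of
    \<open>w * (exp (2 * u) - 1) * v\<close> are kept apart because each is integrable and only the
    exponential one has to be passed to the limit.\<close>
  define E where "E v = (\<integral>x. u x * P v x \<partial>M) + (\<integral>x. h x * v x \<partial>M)
     + ((\<integral>x. w x * (exp (2 * u x) * v x) \<partial>M) - (\<integral>x. w x * v x \<partial>M))" for v
  have w_int: "integrable M (\<lambda>x. w x * v x)" if "v \<in> T" for v
    by (rule w_comp_integrable[of "\<lambda>t. t"]) (use that in auto)
  have E_nonneg: "0 \<le> E v" if v: "v \<in> T" for v
  proof -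
    note [measurable] = T_measurable[OF v]
    obtain C where C: "\<And>x. \<bar>v x\<bar> \<le> C" using T_bounded[OF v] by blast
    define s where "s n = (1/4::real)^n" for n
    have s: "0 < s n" "s n \<le> 1" for n unfolding s_def by (auto intro: power_le_one)
    have s_lim: "s \<longlonglongrightarrow> 0" unfolding s_def[abs_def] by (rule LIMSEQ_power_zero) simp
    \<comment> \<open>At the perturbed function the exponential factors as
      \<open>exp (2 * \<psi> n x) * exp (2 * (s n * v x))\<close>. The second factor joins
      \<open>v\<close>; the result stays bounded and converges to \<open>v\<close>.\<close>
    define \<xi> where "\<xi> n x = exp (2 * (s n * v x)) * v x" for n x
    have \<xi>_meas [measurable]: "\<xi> n \<in> borel_measurable M" for n unfolding \<xi>_def by measurable
    have \<xi>_le: "\<bar>\<xi> n x\<bar> \<le> exp (2 * C) * C" for n x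
    proof -
      have "s n * v x \<le> 1 * C"
        using C[of x] s[of n] by (smt (verit) mult_left_le_one_le mult_le_cancel_left_pos mult_mono mult_minus_right mult_nonneg_nonneg)
      then show ?thesis
        unfolding \<xi>_def abs_mult using C[of x] by (intro mult_mono) auto
    qed
    have \<xi>_lim: "(\<lambda>n. \<xi> n x) \<longlonglongrightarrow> v x" for x
    proof -
      have "(\<lambda>n. \<xi> n x) \<longlonglongrightarrow> exp (2 * (0 * v x)) * v x"
        unfolding \<xi>_def by (intro tendsto_intros s_lim)
      then show ?thesis by simp
    qed
    have lim_exp: "(\<lambda>n. \<integral>x. w x * (exp (2 * \<psi> n x) * \<xi> n x) \<partial>M) \<longlonglongrightarrow> (\<integral>x. w x * (exp (2 * u x) * v x) \<partial>M)"
      by (rule exp_integral_tendsto(2)[OF \<psi> v u(1,2) exp_bound \<xi>_meas \<xi>_le _ _ \<xi>_lim])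
         (auto simp: \<xi>_def)
    have lim_B: "(\<lambda>n. B (\<psi> n) v) \<longlonglongrightarrow> (\<integral>x. u x * P v x \<partial>M)"
      unfolding B_def by (rule L2_tendsto_inner(2)[OF \<psi> u(1,3,4) P_T[OF v]])
    have lower: "- (K * (1/4)^n) \<le> B (\<psi> n) v + s n * B v v + (\<integral>x. h x * v x \<partial>M)
        + ((\<integral>x. w x * (exp (2 * \<psi> n x) * \<xi> n x) \<partial>M) - (\<integral>x. w x * v x \<partial>M))" for n
    proof -
      define \<phi> where "\<phi> = (\<lambda>x. \<psi> n x + s n * v x)"
      have \<phi>: "\<phi> \<in> T" unfolding \<phi>_def by (intro T_add T_scale \<psi> v)
      have "inf_energy \<le> energy (\<psi> n) + s n * energy_deriv \<phi> v"
        using inf_energy_le[OF \<phi>] energy_le_of_deriv[OF \<psi>[of n] v s(1)[of n]] unfolding \<phi>_def by linarith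
      then have "- (K * (1/16)^n) \<le> s n * energy_deriv \<phi> v" using en[of n] by linarith
      moreover have "- (K * (1/16)^n) = s n * - (K * (1/4)^n)"
      proof -
        have "(1/16::real)^n = (1/4)^n * (1/4)^n" by (simp only: power_mult_distrib[symmetric]) simp
        then show ?thesis unfolding s_def by (simp only: minus_mult_right mult.left_commute)
      qed
      ultimately have "- (K * (1/4)^n) \<le> energy_deriv \<phi> v"
        using s(1)[of n] by (simp only: mult_le_cancel_left_pos)
      moreover have "(\<integral>x. w x * ((exp (2 * \<phi> x) - 1) * v x) \<partial>M) =
          (\<integral>x. w x * (exp (2 * \<psi> n x) * \<xi> n x) \<partial>M) - (\<integral>x. w x * v x \<partial>M)"
      proof -
        have eq: "w x * ((exp (2 * \<phi> x) - 1) * v x) = w x * (exp (2 * \<psi> n x) * \<xi> n x) - w x * v x" for x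
          by (simp add: \<phi>_def \<xi>_def distrib_left exp_add algebra_simps)
        have "integrable M (\<lambda>x. (w x * (exp (2 * \<psi> n x) * \<xi> n x) - w x * v x) + w x * v x)"
          using w_exp_integrable[OF \<phi> v] w_int[OF v] unfolding eq by (rule Bochner_Integration.integrable_add)
        then have "integrable M (\<lambda>x. w x * (exp (2 * \<psi> n x) * \<xi> n x))" by simp
        then show ?thesis unfolding eq using w_int[OF v] by simp
      qed
      moreover have "B \<phi> v = B (\<psi> n) v + s n * B v v"
        unfolding \<phi>_def using \<psi> v by (simp add: B_add_left B_scale_left T_scale)
      ultimately show ?thesis unfolding energy_deriv_def by simp
    qed
    have "- (K * 0) \<le> (\<integral>x. u x * P v x \<partial>M) + 0 * B v v + (\<integral>x. h x * v x \<partial>M)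
        + ((\<integral>x. w x * (exp (2 * u x) * v x) \<partial>M) - (\<integral>x. w x * v x \<partial>M))"
    proof (rule LIMSEQ_le[OF _ _ exI[of _ 0]])
      show "(\<lambda>n. - (K * (1/4)^n)) \<longlonglongrightarrow> - (K * 0)"
        by (intro tendsto_intros LIMSEQ_power_zero) simp
      show "(\<lambda>n. B (\<psi> n) v + s n * B v v + (\<integral>x. h x * v x \<partial>M)
        + ((\<integral>x. w x * (exp (2 * \<psi> n x) * \<xi> n x) \<partial>M) - (\<integral>x. w x * v x \<partial>M))) \<longlonglongrightarrow>
        (\<integral>x. u x * P v x \<partial>M) + 0 * B v v + (\<integral>x. h x * v x \<partial>M)
        + ((\<integral>x. w x * (exp (2 * u x) * v x) \<partial>M) - (\<integral>x. w x * v x \<partial>M))"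
        by (intro tendsto_intros lim_B lim_exp s_lim)
    qed (use lower in auto)
    then show ?thesis by (simp add: E_def)
  qed
  have E_zero: "E v = 0" if v: "v \<in> T" for v
  proof -
    have "E (\<lambda>x. (-1) * v x) = - E v"
      unfolding E_def P_scale[OF v] by simp
    with E_nonneg[OF v] E_nonneg[OF T_scale[OF v, of "-1"]] show ?thesis by linarith
  qed
  have split: "(h x + w x * (exp (2 * u x) - 1)) * v x = h x * v x + (w x * (exp (2 * u x) * v x) - w x * v x)" for v x
    by (simp add: algebra_simps)
  show thesis
  proof (rule that[of u \<psi>, OF u(1) u_L2 \<psi> u(4)])
    fix e :: real assume e: "e > 0"
    have "(\<lambda>i. 8 * (K * (1/16)^i)) \<longlonglongrightarrow> 0"
      by (auto intro!: tendsto_mult_right_zero LIMSEQ_power_zero)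
    from LIMSEQ_D[OF this e] obtain i where i: "8 * (K * (1/16)^i) < e"
      using K by auto
    show "\<exists>N. \<forall>m\<ge>N. \<forall>n\<ge>N. (\<integral>x. (\<psi> m x - \<psi> n x) * P (\<lambda>x. \<psi> m x - \<psi> n x) x \<partial>M) < e"
      using B_close i unfolding B_def by (intro exI[of _ i]) (auto intro: le_less_trans)
  next
    fix v assume v: "v \<in> T"
    show "integrable M (\<lambda>x. u x * P v x)"
      by (rule L2_tendsto_inner(1)[OF \<psi> u(1,3,4) P_T[OF v]])
    show "integrable M (\<lambda>x. (h x + w x * (exp (2 * u x) - 1)) * v x)"
      unfolding split using h_mult_integrable[OF v] exp_int[OF v] w_int[OF v] by auto
    show "(\<integral>x. u x * P v x \<partial>M) + (\<integral>x. (h x + w x * (exp (2 * u x) - 1)) * v x \<partial>M) = 0"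
      using E_zero[OF v] h_mult_integrable[OF v] exp_int[OF v] w_int[OF v]
      unfolding split E_def by simp
  qed
qed

end

section \<open>Products of shifts of a positive symmetric operator\<close>

text \<open>A list of shifts covers two cases at once: the factors of the GJMS operator, and powers
  of the negative Laplacian, where all shifts are equal.\<close>

primrec shifted_prod :: "(('a \<Rightarrow> real) \<Rightarrow> 'a \<Rightarrow> real) \<Rightarrow> real list \<Rightarrow> ('a \<Rightarrow> real) \<Rightarrow> 'a \<Rightarrow> real"
  where
    "shifted_prod L [] f = f"
  | "shifted_prod L (a # as) f = shifted_prod L as (\<lambda>x. L f x + a * f x)"

lemma shifted_prod_append: "shifted_prod L (as @ bs) f = shifted_prod L bs (shifted_prod L as f)"
  by (induction as arbitrary: f) auto

locale positive_operator =
  fixes M :: "'a measure" and T :: "('a \<Rightarrow> real) set" and L :: "('a \<Rightarrow> real) \<Rightarrow> 'a \<Rightarrow> real" and c :: real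
  assumes T_add: "\<phi> \<in> T \<Longrightarrow> \<psi> \<in> T \<Longrightarrow> (\<lambda>x. \<phi> x + \<psi> x) \<in> T"
    and T_scale: "\<phi> \<in> T \<Longrightarrow> (\<lambda>x. r * \<phi> x) \<in> T"
    and T_mult_integrable: "\<phi> \<in> T \<Longrightarrow> \<psi> \<in> T \<Longrightarrow> integrable M (\<lambda>x. \<phi> x * \<psi> x)"
    and L_T: "\<phi> \<in> T \<Longrightarrow> L \<phi> \<in> T"
    and L_add: "\<phi> \<in> T \<Longrightarrow> \<psi> \<in> T \<Longrightarrow> L (\<lambda>x. \<phi> x + \<psi> x) = (\<lambda>x. L \<phi> x + L \<psi> x)"
    and L_scale: "\<phi> \<in> T \<Longrightarrow> L (\<lambda>x. r * \<phi> x) = (\<lambda>x. r * L \<phi> x)"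
    and L_sym: "\<phi> \<in> T \<Longrightarrow> \<psi> \<in> T \<Longrightarrow> (\<integral>x. L \<phi> x * \<psi> x \<partial>M) = (\<integral>x. \<phi> x * L \<psi> x \<partial>M)"
    and c_pos: "0 < c"
    and L_pos: "\<phi> \<in> T \<Longrightarrow> c * (\<integral>x. \<phi> x * \<phi> x \<partial>M) \<le> (\<integral>x. L \<phi> x * \<phi> x \<partial>M)"
begin

definition ip :: "('a \<Rightarrow> real) \<Rightarrow> ('a \<Rightarrow> real) \<Rightarrow> real"
  where "ip \<phi> \<psi> = (\<integral>x. \<phi> x * \<psi> x \<partial>M)"

abbreviation shifted where "shifted a \<phi> \<equiv> (\<lambda>x. L \<phi> x + a * \<phi> x)"

lemma ip_commute: "ip \<phi> \<psi> = ip \<psi> \<phi>"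
  by (simp add: ip_def mult.commute)

lemma ip_add: "\<phi> \<in> T \<Longrightarrow> \<psi> \<in> T \<Longrightarrow> v \<in> T \<Longrightarrow> ip (\<lambda>x. \<phi> x + \<psi> x) v = ip \<phi> v + ip \<psi> v"
  by (simp add: ip_def distrib_right T_mult_integrable)

lemma ip_scale: "ip (\<lambda>x. r * \<phi> x) v = r * ip \<phi> v"
  by (simp add: ip_def mult.assoc)

lemma ip_self_nonneg: "0 \<le> ip \<phi> \<phi>"
  by (simp add: ip_def)

lemma ip_L: "\<phi> \<in> T \<Longrightarrow> \<psi> \<in> T \<Longrightarrow> ip (L \<phi>) \<psi> = ip \<phi> (L \<psi>)"
  unfolding ip_def by (rule L_sym)

lemma ip_L_pos: "\<phi> \<in> T \<Longrightarrow> c * ip \<phi> \<phi> \<le> ip (L \<phi>) \<phi>"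
  unfolding ip_def by (rule L_pos)

lemma funpow_T: "\<phi> \<in> T \<Longrightarrow> (L ^^ j) \<phi> \<in> T"
  by (induction j) (auto intro: L_T)

lemma ip_funpow: "\<phi> \<in> T \<Longrightarrow> \<psi> \<in> T \<Longrightarrow> ip ((L ^^ j) \<phi>) \<psi> = ip \<phi> ((L ^^ j) \<psi>)"
proof (induction j arbitrary: \<phi>)
  case (Suc j)
  have "ip ((L ^^ Suc j) \<phi>) \<psi> = ip (L \<phi>) ((L ^^ j) \<psi>)"
    unfolding funpow_Suc_right comp_def using Suc by (auto intro: L_T)
  also have "\<dots> = ip \<phi> ((L ^^ Suc j) \<psi>)"
    using Suc.prems by (simp add: ip_L funpow_T)
  finally show ?case .
qed simp

text \<open>The operator inequality \<open>L^2 \<ge> c * L\<close>. Expanding the square of the norm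
  of \<open>L w - c * w\<close> bounds \<open>2 * c * ip (L w) w\<close> by
  \<open>ip (L w) (L w) + c^2 * ip w w\<close>, and positivity of \<open>L\<close> absorbs the last
  term.\<close>

lemma ip_L_L:
  assumes w: "w \<in> T"
  shows "c * ip (L w) w \<le> ip (L w) (L w)"
proof -
  have Lw: "L w \<in> T" and cw: "(\<lambda>x. (- c) * w x) \<in> T" by (rule L_T[OF w], rule T_scale[OF w])
  have "0 \<le> ip (\<lambda>x. L w x + (- c) * w x) (\<lambda>x. L w x + (- c) * w x)" by (rule ip_self_nonneg)
  also have "\<dots> = ip (L w) (\<lambda>x. L w x + (- c) * w x) + (- c) * ip w (\<lambda>x. L w x + (- c) * w x)"
    by (subst ip_add[OF Lw cw T_add[OF Lw cw]], subst ip_scale) simp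
  also have "ip (L w) (\<lambda>x. L w x + (- c) * w x) = ip (L w) (L w) + (- c) * ip (L w) w"
    by (subst ip_commute, subst ip_add[OF Lw cw Lw], subst ip_scale) (simp add: ip_commute[of w])
  also have "ip w (\<lambda>x. L w x + (- c) * w x) = ip (L w) w + (- c) * ip w w"
    by (subst ip_commute, subst ip_add[OF Lw cw w], subst ip_scale) simp
  finally have "2 * (c * ip (L w) w) \<le> ip (L w) (L w) + c * (c * ip w w)" by (simp add: algebra_simps)
  moreover have "c * (c * ip w w) \<le> c * ip (L w) w"
    using ip_L_pos[OF w] c_pos by (intro mult_left_mono) auto
  ultimately show ?thesis by linarith
qed

section \<open>Moments of the operator\<close>

text \<open>The moments of the spectral measure of \<open>\<phi>\<close>. Comparing them replaces
  functional calculus: every estimate below is an inequality between these numbers.\<close>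

definition moment where "moment j \<phi> = ip ((L ^^ j) \<phi>) \<phi>"

lemma moment_even: "\<phi> \<in> T \<Longrightarrow> moment (i + i) \<phi> = ip ((L ^^ i) \<phi>) ((L ^^ i) \<phi>)"
  unfolding moment_def funpow_add comp_def by (rule ip_funpow) (auto intro: funpow_T)

lemma moment_odd: "\<phi> \<in> T \<Longrightarrow> moment (Suc (i + i)) \<phi> = ip (L ((L ^^ i) \<phi>)) ((L ^^ i) \<phi>)"
proof -
  assume \<phi>: "\<phi> \<in> T"
  have "moment (Suc (i + i)) \<phi> = ip ((L ^^ i) ((L ^^ Suc i) \<phi>)) \<phi>"
    unfolding moment_def by (simp only: funpow_add[symmetric] comp_apply[symmetric, of "L ^^ i"] add_Suc_right)
  also have "\<dots> = ip ((L ^^ Suc i) \<phi>) ((L ^^ i) \<phi>)"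
    by (rule ip_funpow[OF funpow_T[OF \<phi>] \<phi>])
  finally show ?thesis by simp
qed

text \<open>Half of the powers are moved to the other side of the inner product. For even
  \<open>j\<close> this is positivity of \<open>L\<close> at \<open>(L ^^ i) \<phi>\<close>, for odd
  \<open>j\<close> it is \<open>ip_L_L\<close> there; no square root of \<open>L\<close>
  enters.\<close>

lemma moment_Suc:
  assumes "\<phi> \<in> T"
  shows "c * moment j \<phi> \<le> moment (Suc j) \<phi>"
proof (cases "even j")
  case True
  then obtain i where "j = i + i" by (auto elim!: evenE simp: mult_2)
  then show ?thesis
    using ip_L_pos[OF funpow_T[OF assms], of i] by (simp add: moment_even moment_odd assms del: funpow.simps)
next
  case False
  then obtain i where "j = Suc (i + i)" by (auto elim!: oddE simp: mult_2)
  then have "moment (Suc j) \<phi> = ip (L ((L ^^ i) \<phi>)) (L ((L ^^ i) \<phi>))"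
    using moment_even[OF assms, of "Suc i"] by simp
  with \<open>j = Suc (i + i)\<close> show ?thesis
    using ip_L_L[OF funpow_T[OF assms], of i] by (simp add: moment_odd assms del: funpow.simps)
qed

lemma moment_nonneg: "\<phi> \<in> T \<Longrightarrow> 0 \<le> moment j \<phi>"
proof (induction j)
  case (Suc j)
  then show ?case using moment_Suc[of \<phi> j] c_pos by (smt (verit) mult_nonneg_nonneg)
qed (simp add: moment_def ip_self_nonneg)

section \<open>Algebra and size of products of shifts\<close>

lemma shifted_T: "\<phi> \<in> T \<Longrightarrow> shifted a \<phi> \<in> T"
  by (intro T_add T_scale L_T)

lemma shifted_prod_T: "\<phi> \<in> T \<Longrightarrow> shifted_prod L as \<phi> \<in> T"
  by (induction as arbitrary: \<phi>) (auto intro: shifted_T)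

lemma shifted_prod_add: "\<phi> \<in> T \<Longrightarrow> \<psi> \<in> T \<Longrightarrow>
   shifted_prod L as (\<lambda>x. \<phi> x + \<psi> x) = (\<lambda>x. shifted_prod L as \<phi> x + shifted_prod L as \<psi> x)"
proof (induction as arbitrary: \<phi> \<psi>)
  case (Cons a as)
  have "shifted a (\<lambda>x. \<phi> x + \<psi> x) = (\<lambda>x. shifted a \<phi> x + shifted a \<psi> x)"
    using Cons.prems by (auto simp: L_add algebra_simps)
  then show ?case
    using Cons.IH[OF shifted_T shifted_T, OF Cons.prems] by simp
qed simp

lemma shifted_prod_scale: "\<phi> \<in> T \<Longrightarrow>
   shifted_prod L as (\<lambda>x. r * \<phi> x) = (\<lambda>x. r * shifted_prod L as \<phi> x)"
proof (induction as arbitrary: \<phi>)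
  case (Cons a as)
  have "shifted a (\<lambda>x. r * \<phi> x) = (\<lambda>x. r * shifted a \<phi> x)"
    using Cons.prems by (auto simp: L_scale algebra_simps)
  then show ?case
    using Cons.IH[OF shifted_T, OF Cons.prems] by simp
qed simp

lemma shifted_commute: "\<phi> \<in> T \<Longrightarrow> shifted a (shifted b \<phi>) = shifted b (shifted a \<phi>)"
  by (auto simp: L_add L_T T_scale L_scale algebra_simps)

lemma shifted_prod_shifted: "\<phi> \<in> T \<Longrightarrow> shifted_prod L as (shifted a \<phi>) = shifted a (shifted_prod L as \<phi>)"
proof (induction as arbitrary: \<phi>)
  case (Cons b as)
  then show ?case
    by (simp only: shifted_prod.simps shifted_commute[of \<phi> a b] shifted_T)
qed simp

lemma ip_shifted: "\<phi> \<in> T \<Longrightarrow> \<psi> \<in> T \<Longrightarrow> ip (shifted a \<phi>) \<psi> = ip \<phi> (shifted a \<psi>)"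
  unfolding ip_commute[of \<phi>]
  by (simp add: ip_add ip_scale L_T T_scale ip_L ip_commute[of "L \<psi>"] ip_commute[of \<psi> \<phi>])


lemma ip_shifted_prod: "\<phi> \<in> T \<Longrightarrow> \<psi> \<in> T \<Longrightarrow> ip (shifted_prod L as \<phi>) \<psi> = ip \<phi> (shifted_prod L as \<psi>)"
proof (induction as arbitrary: \<phi>)
  case (Cons a as)
  have "ip (shifted_prod L (a # as) \<phi>) \<psi> = ip (shifted a \<phi>) (shifted_prod L as \<psi>)"
    using Cons by (simp add: shifted_T)
  also have "\<dots> = ip \<phi> (shifted a (shifted_prod L as \<psi>))"
    by (rule ip_shifted) (use Cons.prems in \<open>auto intro: shifted_prod_T\<close>)
  finally show ?case using Cons.prems by (simp add: shifted_prod_shifted)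
qed simp

text \<open>The power \<open>j\<close> is the parameter that makes induction on the list work: one
  factor either raises \<open>j\<close> by one or contributes its shift.\<close>

lemma shifted_prod_funpow_Cons:
  assumes "\<phi> \<in> T" "\<psi> \<in> T"
  shows "ip (shifted_prod L (a # as) ((L ^^ j) \<phi>)) \<psi> =
    ip (shifted_prod L as ((L ^^ Suc j) \<phi>)) \<psi> + a * ip (shifted_prod L as ((L ^^ j) \<phi>)) \<psi>"
  using assms funpow_T[of \<phi>]
  by (simp add: shifted_prod_add shifted_prod_scale L_T T_scale ip_add ip_scale shifted_prod_T)

text \<open>Expanded in powers of \<open>L\<close>, the product has nonnegative coefficients and
  every moment is nonnegative, so the top power alone is a lower bound.\<close>

lemma shifted_prod_lower:
  assumes "\<phi> \<in> T" "\<And>a. a \<in> set as \<Longrightarrow> 0 \<le> a"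
  shows "moment (length as + j) \<phi> \<le> ip (shifted_prod L as ((L ^^ j) \<phi>)) \<phi>"
  using assms(2)
proof (induction as arbitrary: j)
  case (Cons a as)
  have "0 \<le> ip (shifted_prod L as ((L ^^ j) \<phi>)) \<phi>"
    using Cons.IH[of j] Cons.prems moment_nonneg[OF assms(1), of "length as + j"] by auto
  then have "0 \<le> a * ip (shifted_prod L as ((L ^^ j) \<phi>)) \<phi>"
    using Cons.prems by simp
  moreover have "moment (length as + Suc j) \<phi> \<le> ip (shifted_prod L as ((L ^^ Suc j) \<phi>)) \<phi>"
    by (rule Cons.IH) (use Cons.prems in auto)
  ultimately show ?case
    unfolding shifted_prod_funpow_Cons[OF assms(1) assms(1)] by simp
qed (simp add: moment_def)

lemma shifted_prod_upper:
  assumes "\<And>a. a \<in> set as \<Longrightarrow> 0 \<le> a"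
  shows "\<exists>C\<ge>0. \<forall>\<phi>\<in>T. \<forall>j. ip (shifted_prod L as ((L ^^ j) \<phi>)) \<phi> \<le> C * moment (length as + j) \<phi>"
  using assms
proof (induction as)
  case Nil
  then show ?case by (intro exI[of _ 1]) (simp add: moment_def)
next
  case (Cons a as)
  then obtain C where C: "0 \<le> C"
    "\<And>\<phi> j. \<phi> \<in> T \<Longrightarrow> ip (shifted_prod L as ((L ^^ j) \<phi>)) \<phi> \<le> C * moment (length as + j) \<phi>"
    by auto
  have a: "0 \<le> a" using Cons.prems by simp
  show ?case
  \<comment> \<open>\<open>C\<close> accounts for the power of \<open>L\<close> in the new factor;
    \<open>a * (C / c)\<close> for its shift, whose moment is one degree too low and is raised at
    the price \<open>1 / c\<close>.\<close>
  proof (intro exI[of _ "C + a * (C / c)"] conjI ballI allI)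
    show "0 \<le> C + a * (C / c)" using C(1) a c_pos by simp
    fix \<phi> j assume \<phi>: "\<phi> \<in> T"
    have "ip (shifted_prod L as ((L ^^ j) \<phi>)) \<phi> \<le> C * moment (length as + j) \<phi>" by (rule C(2)[OF \<phi>])
    also have "\<dots> \<le> C / c * moment (length (a # as) + j) \<phi>"
      using mult_left_mono[OF moment_Suc[OF \<phi>, of "length as + j"], of "C / c"] C(1) c_pos by simp
    finally have "a * ip (shifted_prod L as ((L ^^ j) \<phi>)) \<phi> \<le> a * (C / c * moment (length (a # as) + j) \<phi>)"
      using a by (rule mult_left_mono)
    then show "ip (shifted_prod L (a # as) ((L ^^ j) \<phi>)) \<phi> \<le> (C + a * (C / c)) * moment (length (a # as) + j) \<phi>"
      unfolding shifted_prod_funpow_Cons[OF \<phi> \<phi>] using C(2)[OF \<phi>, of "Suc j"] by (simp add: algebra_simps)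
  qed
qed

lemma moment_le_power:
  assumes "\<phi> \<in> T"
  shows "c ^ i * moment j \<phi> \<le> moment (i + j) \<phi>"
proof (induction i)
  case (Suc i)
  then show ?case
    using order_trans[OF mult_left_mono[OF Suc, of c] moment_Suc[OF assms, of "i + j"]] c_pos
    by (simp add: mult.assoc)
qed simp

text \<open>Both products are compared with the moment of their degree, so the shifts need not
  match. The gap in degree \<open>i\<close> costs \<open>1 / c ^ i\<close>.\<close>

lemma shifted_prod_compare:
  assumes "length as \<le> length bs" and as: "\<And>a. a \<in> set as \<Longrightarrow> 0 \<le> a" and bs: "\<And>b. b \<in> set bs \<Longrightarrow> 0 \<le> (b::real)"
  obtains C :: real where "0 < C" "\<And>\<phi>. \<phi> \<in> T \<Longrightarrow> ip (shifted_prod L as \<phi>) \<phi> \<le> C * ip (shifted_prod L bs \<phi>) \<phi>"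
proof -
  obtain C where C: "0 \<le> C"
    "\<And>\<phi> j. \<phi> \<in> T \<Longrightarrow> ip (shifted_prod L as ((L ^^ j) \<phi>)) \<phi> \<le> C * moment (length as + j) \<phi>"
    using shifted_prod_upper[OF as] by metis
  define i where "i = length bs - length as"
  define D where "D = C / c ^ i"
  have D: "0 \<le> D" using C(1) c_pos by (simp add: D_def)
  have "ip (shifted_prod L as \<phi>) \<phi> \<le> (D + 1) * ip (shifted_prod L bs \<phi>) \<phi>" if \<phi>: "\<phi> \<in> T" for \<phi>
  proof -
    have lb: "moment (length bs) \<phi> \<le> ip (shifted_prod L bs \<phi>) \<phi>"
      using shifted_prod_lower[OF \<phi> bs, where j=0] by simp
    have "ip (shifted_prod L as \<phi>) \<phi> \<le> C * moment (length as) \<phi>"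
      using C(2)[OF \<phi>, of 0] by simp
    also have "\<dots> = D * (c ^ i * moment (length as) \<phi>)"
      using c_pos by (simp add: D_def)
    also have "\<dots> \<le> D * moment (length bs) \<phi>"
      using moment_le_power[OF \<phi>, of i "length as"] assms(1) by (intro mult_left_mono D) (simp add: i_def)
    also have "\<dots> \<le> (D + 1) * moment (length bs) \<phi>"
      using moment_nonneg[OF \<phi>] by (intro mult_right_mono) auto
    also have "\<dots> \<le> (D + 1) * ip (shifted_prod L bs \<phi>) \<phi>"
      using lb D by (intro mult_left_mono) auto
    finally show ?thesis .
  qed
  with D show thesis by (intro that[of "D + 1"]) auto
qed

end

section \<open>Calculus of test functions on the hyperbolic ball\<close>

lemma partial_eqI: "(f has_derivative D) (at x) \<Longrightarrow> partial b f x = D b"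
  unfolding partial_def by (metis frechet_derivative_at)

lemma has_derivative_partial:
  "f differentiable (at x) \<Longrightarrow> (f has_derivative (\<lambda>b. partial b f x)) (at x)"
  unfolding partial_def by (simp add: frechet_derivative_works[symmetric])

text \<open>Holds without differentiability: \<open>frechet_derivative\<close> chooses among the
  derivatives at a point, and functions that agree near the point have the same ones.\<close>

lemma partial_cong_open:
  assumes "open S" "x \<in> S" "\<And>y. y \<in> S \<Longrightarrow> f y = g y"
  shows "partial b f x = partial b g x"
proof -
  have "(f has_derivative D) (at x) \<longleftrightarrow> (g has_derivative D) (at x)" for D
    using assms by (metis has_derivative_transform_within_open)
  then show ?thesis by (simp add: partial_def frechet_derivative_def)
qed

lemma partial_add:
  assumes "f differentiable (at x)" "g differentiable (at x)"
  shows "partial b (\<lambda>x. f x + g x) x = partial b f x + partial b g x"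
  using assms by (intro partial_eqI) (auto intro!: derivative_eq_intros has_derivative_partial)

lemma partial_mult:
  assumes "f differentiable (at x)" "g differentiable (at x)"
  shows "partial b (\<lambda>x. f x * g x) x = f x * partial b g x + partial b f x * g x"
  using assms by (intro partial_eqI) (auto intro!: derivative_eq_intros has_derivative_partial)

lemma partial_const [simp]: "partial b (\<lambda>x. c) = (\<lambda>x. 0)"
  by (rule ext, rule partial_eqI[of _ "\<lambda>_. 0"]) simp

lemma partial_inner_left [simp]: "partial b (\<lambda>x. x \<bullet> c) = (\<lambda>x. b \<bullet> c)"
  by (rule ext, rule partial_eqI[of _ "\<lambda>h. h \<bullet> c"]) (auto intro!: derivative_eq_intros)

lemma cont_diff_Suc_imp: "cont_diff (Suc n) f \<Longrightarrow> cont_diff n f"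
proof (induction n arbitrary: f)
  case 0
  then show ?case
    by (auto intro!: continuous_at_imp_continuous_on differentiable_imp_continuous_within)
next
  case (Suc n)
  then show ?case by (subst cont_diff.simps(2), subst (asm) (2) cont_diff.simps(2)) auto
qed

lemma cont_diff_const: "cont_diff n (\<lambda>x. c)"
  by (induction n arbitrary: c) auto

lemma cont_diff_inner_left: "cont_diff n (\<lambda>x. x \<bullet> c)"
  by (cases n) (auto simp: cont_diff_const intro!: continuous_intros)

lemma cont_diff_add: "cont_diff n f \<Longrightarrow> cont_diff n g \<Longrightarrow> cont_diff n (\<lambda>x. f x + g x)"
proof (induction n arbitrary: f g)
  case (Suc n)
  then have "partial b (\<lambda>x. f x + g x) = (\<lambda>x. partial b f x + partial b g x)" for b
    by (auto intro!: partial_add)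
  with Suc show ?case by auto
qed (auto intro: continuous_intros)

lemma cont_diff_mult: "cont_diff n f \<Longrightarrow> cont_diff n g \<Longrightarrow> cont_diff n (\<lambda>x. f x * g x)"
proof (induction n arbitrary: f g)
  case (Suc n)
  then have "partial b (\<lambda>x. f x * g x) = (\<lambda>x. f x * partial b g x + partial b f x * g x)" for b
    by (auto intro!: partial_mult)
  moreover have "cont_diff n f" "cont_diff n g"
    using Suc.prems by (auto intro: cont_diff_Suc_imp)
  ultimately show ?case using Suc by (auto intro!: cont_diff_add)
qed (auto intro: continuous_intros)

section \<open>The algebra of test functions\<close>

lemma test_cont_diff: "\<phi> \<in> test_functions \<Longrightarrow> cont_diff n \<phi>"
  by (simp add: test_functions_def)

lemma test_differentiable: "\<phi> \<in> test_functions \<Longrightarrow> \<phi> differentiable (at x)"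
  using test_cont_diff[of \<phi> 1] by simp

lemma test_continuous: "\<phi> \<in> test_functions \<Longrightarrow> continuous_on UNIV \<phi>"
  using test_cont_diff[of \<phi> 0] by simp

lemma test_support:
  assumes "\<phi> \<in> test_functions"
  obtains K where "compact K" "K \<subseteq> ball 0 1" "\<And>x. x \<notin> K \<Longrightarrow> \<phi> x = 0"
  using assms by (auto simp: test_functions_def)

lemma test_outside_ball: "\<phi> \<in> test_functions \<Longrightarrow> x \<notin> ball 0 1 \<Longrightarrow> \<phi> x = 0"
  by (meson subsetD test_support)

lemma test_functionsI:
  assumes "\<And>n. cont_diff n f" "compact K" "K \<subseteq> ball 0 1" "\<And>x. x \<notin> K \<Longrightarrow> f x = 0"
  shows "f \<in> test_functions"
  using assms by (auto simp: test_functions_def)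

lemma test_add:
  assumes "\<phi> \<in> test_functions" "\<psi> \<in> test_functions"
  shows "(\<lambda>x. \<phi> x + \<psi> x) \<in> test_functions"
proof -
  obtain K L where KL: "compact K" "K \<subseteq> ball 0 1" "\<And>x. x \<notin> K \<Longrightarrow> \<phi> x = 0"
     "compact L" "L \<subseteq> ball 0 1" "\<And>x. x \<notin> L \<Longrightarrow> \<psi> x = 0"
    using assms by (metis test_support)
  show ?thesis
    by (rule test_functionsI[of _ "K \<union> L"])
       (use KL in \<open>auto intro!: cont_diff_add assms[THEN test_cont_diff]\<close>)
qed

lemma test_smooth_mult:
  assumes "\<And>n. cont_diff n f" "\<phi> \<in> test_functions"
  shows "(\<lambda>x. f x * \<phi> x) \<in> test_functions"
proof -
  obtain K where K: "compact K" "K \<subseteq> ball 0 1" "\<And>x. x \<notin> K \<Longrightarrow> \<phi> x = 0"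
    using assms by (metis test_support)
  show ?thesis
    by (rule test_functionsI[of _ K])
      (use K in \<open>auto intro!: cont_diff_mult assms(1) test_cont_diff[OF assms(2)]\<close>)
qed

lemma test_mult:
  "\<phi> \<in> test_functions \<Longrightarrow> \<psi> \<in> test_functions \<Longrightarrow> (\<lambda>x. \<phi> x * \<psi> x) \<in> test_functions"
  by (rule test_smooth_mult) (auto intro: test_cont_diff)

lemma test_scale: "\<phi> \<in> test_functions \<Longrightarrow> (\<lambda>x. c * \<phi> x) \<in> test_functions"
  by (rule test_smooth_mult) (auto intro: cont_diff_const)

lemma test_inner_mult: "\<phi> \<in> test_functions \<Longrightarrow> (\<lambda>x. x \<bullet> b * \<phi> x) \<in> test_functions"
  by (rule test_smooth_mult) (auto intro: cont_diff_inner_left)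

lemma test_minus: "\<phi> \<in> test_functions \<Longrightarrow> (\<lambda>x. - \<phi> x) \<in> test_functions"
  using test_scale[of \<phi> "-1"] by simp

lemma test_diff:
  "\<phi> \<in> test_functions \<Longrightarrow> \<psi> \<in> test_functions \<Longrightarrow> (\<lambda>x. \<phi> x - \<psi> x) \<in> test_functions"
  using test_add[OF _ test_minus, of \<phi> \<psi>] by simp

lemma test_zero: "(\<lambda>x. 0) \<in> test_functions"
  by (rule test_functionsI[of _ "{}"]) (auto intro: cont_diff_const)

lemma test_sum:
  "(\<And>i. i \<in> I \<Longrightarrow> \<phi> i \<in> test_functions) \<Longrightarrow> (\<lambda>x. \<Sum>i\<in>I. \<phi> i x) \<in> test_functions"
  by (induction I rule: infinite_finite_induct) (auto intro: test_add test_zero)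

lemma test_partial:
  assumes "\<phi> \<in> test_functions" "b \<in> Basis"
  shows "partial b \<phi> \<in> test_functions"
proof -
  obtain K where K: "compact K" "K \<subseteq> ball 0 1" "\<And>x. x \<notin> K \<Longrightarrow> \<phi> x = 0"
    using assms by (metis test_support)
  have "partial b \<phi> x = 0" if "x \<notin> K" for x
    using partial_cong_open[of "- K" x \<phi> "\<lambda>_. 0" b] K that
    by (auto simp: open_Compl compact_imp_closed)
  moreover have "cont_diff n (partial b \<phi>)" for n
    using test_cont_diff[OF assms(1), of "Suc n"] assms(2) by simp
  ultimately show ?thesis using K by (intro test_functionsI[of _ K]) auto
qed

section \<open>The conformal factor\<close>

lemma norm_ball_power2: "x \<in> ball 0 1 \<Longrightarrow> (norm x)\<^sup>2 < 1"
  by (simp add: power_less_one_iff abs_square_less_1)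

lemma hyp_factor_ge_2: "x \<in> ball 0 1 \<Longrightarrow> hyp_factor x \<ge> 2"
  using norm_ball_power2[of x] by (simp add: hyp_factor_def field_simps)

lemma hyp_factor_has_derivative:
  assumes "x \<in> ball 0 1"
  shows "(hyp_factor has_derivative (\<lambda>h. (hyp_factor x)\<^sup>2 * (x \<bullet> h))) (at x)"
proof -
  have "1 - x \<bullet> x \<noteq> 0"
    using norm_ball_power2[OF assms] by (simp add: power2_norm_eq_inner)
  then show ?thesis
    unfolding hyp_factor_def power2_norm_eq_inner
    by (auto intro!: derivative_eq_intros simp: field_simps power2_eq_square inner_commute)
qed

lemma partial_hyp_factor_power_mult:
  assumes "x \<in> ball 0 1" "f differentiable (at x)"
  shows "partial b (\<lambda>y. hyp_factor y ^ m * f y) x =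
    hyp_factor x ^ m * (partial b f x + real m * hyp_factor x * (x \<bullet> b) * f x)"
proof (rule partial_eqI)
  have "((\<lambda>y. hyp_factor y ^ m) has_derivative
      (\<lambda>h. real m * ((hyp_factor x)\<^sup>2 * (x \<bullet> h)) * hyp_factor x ^ (m - 1))) (at x)"
    by (rule has_derivative_power[OF hyp_factor_has_derivative[OF assms(1)]])
  \<comment> \<open>The exponent \<open>m - 1\<close> is truncated at \<open>m = 0\<close>, where
    the factor \<open>real m\<close> makes both sides 0.\<close>
  moreover have "real m * ((hyp_factor x)\<^sup>2 * (x \<bullet> h)) * hyp_factor x ^ (m - 1)
     = real m * (hyp_factor x ^ Suc m * (x \<bullet> h))" for h
    by (cases m) (auto simp: power2_eq_square)
  ultimately have "((\<lambda>y. hyp_factor y ^ m) has_derivative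
      (\<lambda>h. real m * (hyp_factor x ^ Suc m * (x \<bullet> h)))) (at x)" by (simp only:)
  from has_derivative_mult[OF this has_derivative_partial[OF assms(2)]]
  show "((\<lambda>y. hyp_factor y ^ m * f y) has_derivative (\<lambda>b.
    hyp_factor x ^ m * (partial b f x + real m * hyp_factor x * (x \<bullet> b) * f x))) (at x)"
    by (simp add: algebra_simps)
qed

text \<open>The conformal factor is singular on the unit sphere, but \<open>\<phi>\<close> vanishes
  near every point outside the ball, so the formula holds on the whole space. For basis vectors its
  right side again consists of powers of the factor times test functions.\<close>

lemma test_partial_hyp_factor_power_mult:
  assumes "\<phi> \<in> test_functions"
  shows "(\<lambda>y. hyp_factor y ^ m * \<phi> y) differentiable (at x)"
    and "partial b (\<lambda>y. hyp_factor y ^ m * \<phi> y) x =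
      hyp_factor x ^ m * partial b \<phi> x + real m * (hyp_factor x ^ Suc m * (x \<bullet> b * \<phi> x))"
proof -
  obtain K where K: "compact K" "K \<subseteq> ball 0 1" "\<And>x. x \<notin> K \<Longrightarrow> \<phi> x = 0"
    using assms by (metis test_support)
  have o: "open (- K)" using K by (simp add: open_Compl compact_imp_closed)
  show "(\<lambda>y. hyp_factor y ^ m * \<phi> y) differentiable (at x)"
  proof (cases "x \<in> ball 0 1")
    case True
    then show ?thesis
      using hyp_factor_has_derivative[OF True] test_differentiable[OF assms]
      by (intro differentiable_mult differentiable_power) (auto simp: differentiable_def)
  next
    case False
    have "((\<lambda>y. hyp_factor y ^ m * \<phi> y) has_derivative (\<lambda>_. 0)) (at x)"
      by (rule has_derivative_transform_within_open[OF has_derivative_const[of 0] o])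
         (use K False in auto)
    then show ?thesis by (auto simp: differentiable_def)
  qed
  show "partial b (\<lambda>y. hyp_factor y ^ m * \<phi> y) x =
      hyp_factor x ^ m * partial b \<phi> x + real m * (hyp_factor x ^ Suc m * (x \<bullet> b * \<phi> x))"
  proof (cases "x \<in> ball 0 1")
    case True
    then show ?thesis
      by (subst partial_hyp_factor_power_mult) (auto simp: test_differentiable[OF assms] algebra_simps)
  next
    case False
    then have x: "x \<in> - K" using K by auto
    have "partial b (\<lambda>y. hyp_factor y ^ m * \<phi> y) x = partial b (\<lambda>_. 0) x"
      by (rule partial_cong_open[OF o x]) (use K in auto)
    moreover have "partial b \<phi> x = partial b (\<lambda>_. 0) x"
      by (rule partial_cong_open[OF o x]) (use K in auto)
    ultimately show ?thesis using K x by simp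
  qed
qed

text \<open>The induction on the order of smoothness runs over all \<open>m\<close> and
  \<open>\<phi>\<close> at once, since differentiation raises the exponent and changes the test
  function.\<close>

lemma test_hyp_factor_power_mult:
  assumes "\<phi> \<in> test_functions"
  shows "(\<lambda>x. hyp_factor x ^ m * \<phi> x) \<in> test_functions"
proof -
  have "cont_diff n (\<lambda>x. hyp_factor x ^ m * \<phi> x)" if "\<phi> \<in> test_functions" for n m \<phi>
    using that
  proof (induction n arbitrary: m \<phi>)
    case 0
    then show ?case
      using test_partial_hyp_factor_power_mult(1)
      by (auto intro!: continuous_at_imp_continuous_on differentiable_imp_continuous_within)
  next
    case (Suc n)
    have "partial b (\<lambda>y. hyp_factor y ^ m * \<phi> y) = (\<lambda>x.
      hyp_factor x ^ m * partial b \<phi> x + real m * (hyp_factor x ^ Suc m * (x \<bullet> b * \<phi> x)))" for b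
      using test_partial_hyp_factor_power_mult(2)[OF Suc.prems] by blast
    with Suc show ?case
      by (auto intro!: cont_diff_add cont_diff_mult[OF cont_diff_const]
          Suc.IH[of _ "Suc m", simplified] test_partial test_inner_mult
          test_partial_hyp_factor_power_mult(1) simp del: power_Suc)
  qed
  note cd = this[OF assms]
  obtain K where "compact K" "K \<subseteq> ball 0 1" "\<And>x. x \<notin> K \<Longrightarrow> \<phi> x = 0"
    using assms by (metis test_support)
  then show ?thesis
    by (intro test_functionsI[of _ K] cd) auto
qed

section \<open>Euclidean integrals of test functions\<close>

lemma test_bounded:
  assumes "\<phi> \<in> test_functions"
  obtains C where "\<And>x. \<bar>\<phi> x\<bar> \<le> C"
proof -
  obtain K where K: "compact K" "\<And>x. x \<notin> K \<Longrightarrow> \<phi> x = 0"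
    using assms by (metis test_support)
  have "compact (\<phi> ` K)"
    using K test_continuous[OF assms] by (intro compact_continuous_image) (auto intro: continuous_on_subset)
  then obtain C where C: "\<And>x. x \<in> K \<Longrightarrow> \<bar>\<phi> x\<bar> \<le> C"
    by (force dest!: compact_imp_bounded simp: bounded_iff)
  have "\<bar>\<phi> x\<bar> \<le> max C 0" for x
    by (cases "x \<in> K") (use C[of x] K(2)[of x] in auto)
  then show thesis by (rule that)
qed

lemma test_integrable_lborel:
  assumes "\<phi> \<in> test_functions"
  shows "integrable lborel \<phi>"
proof -
  obtain K where K: "compact K" "\<And>x. x \<notin> K \<Longrightarrow> \<phi> x = 0"
    using assms by (metis test_support)
  have "integrable lborel (\<lambda>x. indicator K x *\<^sub>R \<phi> x)"
    by (rule borel_integrable_compact) (use K test_continuous[OF assms] in \<open>auto intro: continuous_on_subset\<close>)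
  also have "(\<lambda>x. indicator K x *\<^sub>R \<phi> x) = \<phi>" using K(2) by (force simp: indicator_def)
  finally show ?thesis .
qed

lemma has_real_derivative_along:
  assumes "f differentiable (at (x + t *\<^sub>R b))"
  shows "((\<lambda>s. f (x + s *\<^sub>R b)) has_real_derivative partial b f (x + t *\<^sub>R b)) (at t)"
proof -
  have "((\<lambda>s. x + s *\<^sub>R b) has_derivative (\<lambda>h. h *\<^sub>R b)) (at t)"
    by (auto intro!: derivative_eq_intros)
  from has_derivative_compose[OF this has_derivative_partial[OF assms]]
  have "((\<lambda>s. f (x + s *\<^sub>R b)) has_derivative (\<lambda>h. partial (h *\<^sub>R b) f (x + t *\<^sub>R b))) (at t)" .
  moreover have "(\<lambda>h. partial (h *\<^sub>R b) f (x + t *\<^sub>R b)) = (*) (partial b f (x + t *\<^sub>R b))"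
    using linear_scale[OF has_derivative_linear[OF has_derivative_partial[OF assms]]]
    by (auto simp: mult.commute)
  ultimately show ?thesis
    unfolding has_field_derivative_def by (simp only:)
qed

text \<open>By translation invariance the difference quotients of \<open>\<phi>\<close> have integral zero.\<close>

lemma integral_partial_test:
  fixes \<phi> :: "'a::euclidean_space \<Rightarrow> real"
  assumes \<phi>: "\<phi> \<in> test_functions" and b: "b \<in> Basis"
  shows "(\<integral>x. partial b \<phi> x \<partial>lborel) = 0"
proof -
  define q where "q n x = (\<phi> (x + (1 / real (Suc n)) *\<^sub>R b) - \<phi> x) * real (Suc n)" for n x
  have \<phi>': "partial b \<phi> \<in> test_functions" by (rule test_partial[OF assms])
  note int = test_integrable_lborel[OF \<phi>]
  have shift: "integrable lborel (\<lambda>x. \<phi> (x + a))" "(\<integral>x. \<phi> (x + a) \<partial>lborel) = (\<integral>x. \<phi> x \<partial>lborel)" for a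
  proof -
    have "integrable (distr lborel borel ((+) a)) \<phi>" "(\<integral>x. \<phi> x \<partial>distr lborel borel ((+) a)) = (\<integral>x. \<phi> x \<partial>lborel)"
      using int by (simp_all only: lborel_distr_plus)
    then show "integrable lborel (\<lambda>x. \<phi> (x + a))" "(\<integral>x. \<phi> (x + a) \<partial>lborel) = (\<integral>x. \<phi> x \<partial>lborel)"
      using int by (simp_all add: integrable_distr_eq integral_distr add.commute)
  qed
  have q0: "(\<integral>x. q n x \<partial>lborel) = 0" for n
    unfolding q_def using int shift by simp
  obtain C where C: "\<And>x. \<bar>partial b \<phi> x\<bar> \<le> C"
    using test_bounded[OF \<phi>'] by blast
  have "0 \<le> C" using C[of 0] by simp
  \<comment> \<open>The translates move points by at most 1, so the quotients vanish beyond radius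
    2; within it the mean value theorem bounds them by the derivative.\<close>
  have q_le: "\<bar>q n x\<bar> \<le> C * indicator (cball 0 2) x" for n x
  proof (cases "x \<in> cball 0 2")
    case False
    then have n: "norm x > 2" by simp
    have b1: "norm ((1 / real (Suc n)) *\<^sub>R b) \<le> 1" using b by (simp add: field_simps)
    have "norm (x + (1 / real (Suc n)) *\<^sub>R b) \<ge> norm x - norm ((1 / real (Suc n)) *\<^sub>R b)"
      by (rule norm_diff_ineq)
    with n b1 have "\<not> norm (x + (1 / real (Suc n)) *\<^sub>R b) < 1" by linarith
    with n False show ?thesis
      by (auto simp: q_def test_outside_ball[OF \<phi>])
  next
    case True
    have d: "((\<lambda>t. \<phi> (x + t *\<^sub>R b)) has_real_derivative partial b \<phi> (x + t *\<^sub>R b)) (at t)" for t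
      by (rule has_real_derivative_along[OF test_differentiable[OF \<phi>]])
    have "\<exists>t. t > 0 \<and> t < 1 / real (Suc n) \<and> \<phi> (x + (1 / real (Suc n)) *\<^sub>R b) - \<phi> (x + 0 *\<^sub>R b) =
      (1 / real (Suc n) - 0) * partial b \<phi> (x + t *\<^sub>R b)"
      by (rule MVT2) (auto intro: d)
    then obtain t where "\<phi> (x + (1 / real (Suc n)) *\<^sub>R b) - \<phi> x =
      (1 / real (Suc n)) * partial b \<phi> (x + t *\<^sub>R b)" by auto
    then have "q n x = partial b \<phi> (x + t *\<^sub>R b)" by (simp add: q_def field_simps)
    with C True show ?thesis by simp
  qed
  have lim: "(\<lambda>n. q n x) \<longlonglongrightarrow> partial b \<phi> x" for x
  proof -
    have "((\<lambda>t. \<phi> (x + t *\<^sub>R b)) has_real_derivative partial b \<phi> (x + 0 *\<^sub>R b)) (at 0)"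
      by (rule has_real_derivative_along[OF test_differentiable[OF \<phi>]])
    then have "((\<lambda>h. (\<phi> (x + h *\<^sub>R b) - \<phi> x) / h) \<longlongrightarrow> partial b \<phi> x) (at 0)"
      by (simp add: DERIV_def)
    then have "(\<lambda>n. (\<phi> (x + (1 / real (Suc n)) *\<^sub>R b) - \<phi> x) / (1 / real (Suc n))) \<longlonglongrightarrow> partial b \<phi> x"
      by (rule filterlim_compose)
        (auto simp: filterlim_at intro: LIMSEQ_Suc[OF lim_1_over_n, simplified])
    then show ?thesis by (simp add: q_def)
  qed
  have "(\<lambda>n. \<integral>x. q n x \<partial>lborel) \<longlonglongrightarrow> (\<integral>x. partial b \<phi> x \<partial>lborel)"
  proof (rule integral_dominated_convergence[where w = "\<lambda>x. C * indicator (cball 0 2) x"])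
    show "integrable lborel (\<lambda>x. C * indicator (cball 0 2 :: 'a set) x)"
      by (intro integrable_mult_right integrable_real_indicator) (use emeasure_lborel_cball_finite in auto)
    show "q n \<in> borel_measurable lborel" for n
      unfolding q_def using int shift(1) by (intro borel_measurable_times borel_measurable_diff) auto
    show "partial b \<phi> \<in> borel_measurable lborel"
      using test_integrable_lborel[OF \<phi>'] by auto
  qed (use lim q_le in auto)
  then show ?thesis by (simp add: q0 LIMSEQ_const_iff)
qed


section \<open>The Laplace-Beltrami operator on test functions\<close>

lemma cont_diff_sum: "(\<And>i. i \<in> I \<Longrightarrow> cont_diff n (f i)) \<Longrightarrow> cont_diff n (\<lambda>x. \<Sum>i\<in>I. f i x)"
  by (induction I rule: infinite_finite_induct) (auto intro: cont_diff_add cont_diff_const)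

text \<open>The reciprocal of \<open>hyp_factor\<close> in the ball, written as a polynomial and
  hence smooth on the whole space.\<close>

definition inv_factor :: "'a::euclidean_space \<Rightarrow> real"
  where "inv_factor x = (1 - x \<bullet> x) / 2"

lemma cont_diff_inv_factor: "cont_diff n inv_factor"
proof -
  have "inv_factor = (\<lambda>x::'a. 1 / 2 + (\<Sum>b\<in>Basis. (- 1 / 2) * (x \<bullet> b * (x \<bullet> b))))"
    by (auto simp: inv_factor_def euclidean_inner[of x x for x] sum_distrib_left[symmetric] sum_negf sum_divide_distrib[symmetric])
  then show ?thesis
    by (rule ssubst) (intro cont_diff_add cont_diff_sum cont_diff_mult cont_diff_const cont_diff_inner_left)
qed

lemma hyp_factor_inv_factor: "x \<in> ball 0 1 \<Longrightarrow> hyp_factor x * inv_factor x = 1"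
  using norm_ball_power2[of x] by (simp add: hyp_factor_def inv_factor_def power2_norm_eq_inner)

lemma hyp_grad_inner:
  "b \<in> Basis \<Longrightarrow> hyp_grad \<phi> x \<bullet> b = partial b \<phi> x / (hyp_factor x)\<^sup>2"
  by (simp add: hyp_grad_def)

text \<open>Divergence form: the volume density supplies the exponent \<open>N\<close> and the
  gradient removes 2. The dimension bound makes the truncated subtraction exact.\<close>

lemma hyp_laplace_ball:
  fixes \<phi> :: "'a::euclidean_space \<Rightarrow> real"
  assumes "\<phi> \<in> test_functions" "x \<in> ball 0 1" "DIM('a) \<ge> 2"
  shows "hyp_factor x ^ DIM('a) * hyp_laplace \<phi> x =
    (\<Sum>b\<in>Basis. partial b (\<lambda>y. hyp_factor y ^ (DIM('a) - 2) * partial b \<phi> y) x)"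
proof -
  obtain n where n: "DIM('a) = n + 2" using assms(3) by (metis add.commute le_Suc_ex)
  have "partial b (\<lambda>y. hyp_factor y ^ DIM('a) * (hyp_grad \<phi> y \<bullet> b)) x =
      partial b (\<lambda>y. hyp_factor y ^ (DIM('a) - 2) * partial b \<phi> y) x" if b: "b \<in> Basis" for b
  proof (rule partial_cong_open[OF open_ball assms(2)])
    fix y :: 'a assume "y \<in> ball 0 1"
    then have "hyp_factor y \<noteq> 0" using hyp_factor_ge_2[of y] by auto
    then show "hyp_factor y ^ DIM('a) * (hyp_grad \<phi> y \<bullet> b) = hyp_factor y ^ (DIM('a) - 2) * partial b \<phi> y"
      by (simp add: hyp_grad_inner[OF b] n power_add power2_eq_square)
  qed
  moreover have "hyp_factor x \<noteq> 0" using hyp_factor_ge_2[OF assms(2)] by auto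
  ultimately show ?thesis by (simp add: hyp_laplace_def hyp_div_def)
qed

text \<open>Carrying out the derivative leaves polynomial coefficients, and both sides vanish off
  the ball. From this global formula the invariance of test functions and the linearity of the
  operator can be read off.\<close>

lemma hyp_laplace_test:
  fixes \<phi> :: "'a::euclidean_space \<Rightarrow> real"
  assumes \<phi>: "\<phi> \<in> test_functions" and dim: "DIM('a) \<ge> 2"
  shows "hyp_laplace \<phi> = (\<lambda>x. \<Sum>b\<in>Basis. inv_factor x * (inv_factor x * partial b (partial b \<phi>) x) +
    real (DIM('a) - 2) * (inv_factor x * (x \<bullet> b * partial b \<phi> x)))"
proof
  fix x
  obtain n where n: "DIM('a) = n + 2" using dim by (metis add.commute le_Suc_ex)
  show "hyp_laplace \<phi> x = (\<Sum>b\<in>Basis. inv_factor x * (inv_factor x * partial b (partial b \<phi>) x) +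
    real (DIM('a) - 2) * (inv_factor x * (x \<bullet> b * partial b \<phi> x)))"
  proof (cases "x \<in> ball 0 1")
    case True
    define F G where "F = hyp_factor x" and "G = inv_factor x"
    have FG: "F * G = 1" unfolding F_def G_def by (rule hyp_factor_inv_factor[OF True])
    then have F: "F \<noteq> 0" by auto
    have "F ^ DIM('a) * hyp_laplace \<phi> x = (\<Sum>b\<in>Basis. F ^ n * partial b (partial b \<phi>) x
        + real n * (F ^ Suc n * (x \<bullet> b * partial b \<phi> x)))"
      unfolding F_def hyp_laplace_ball[OF \<phi> True dim]
      by (intro sum.cong) (auto simp: n test_partial_hyp_factor_power_mult(2)[OF test_partial[OF \<phi>]])
    also have "\<dots> = F ^ DIM('a) * (\<Sum>b\<in>Basis. G * (G * partial b (partial b \<phi>) x)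
        + real n * (G * (x \<bullet> b * partial b \<phi> x)))"
    proof -
      have "F ^ DIM('a) * (G * (G * p) + real n * (G * q)) = (F * G) * (F * G) * F ^ n * p + real n * ((F * G) * F ^ Suc n * q)" for p q
        by (simp add: n algebra_simps)
      then show ?thesis unfolding FG by (simp add: sum_distrib_left)
    qed
    finally show ?thesis using F by (simp add: F_def G_def n)
  next
    case False
    obtain K where K: "compact K" "K \<subseteq> ball 0 1" "\<And>x. x \<notin> K \<Longrightarrow> \<phi> x = 0"
      using \<phi> by (metis test_support)
    have o: "open (- K)" using K by (simp add: open_Compl compact_imp_closed)
    have x: "x \<in> - K" using False K by auto
    have "partial b \<phi> y = partial b (\<lambda>_. 0) y" if "y \<in> - K" for b y
      by (rule partial_cong_open[OF o that]) (use K in auto)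
    then have g0: "hyp_grad \<phi> y = 0" if "y \<in> - K" for y using that by (simp add: hyp_grad_def)
    have "partial b (\<lambda>y. hyp_factor y ^ DIM('a) * (hyp_grad \<phi> y \<bullet> b)) x = partial b (\<lambda>_. 0) x" for b
      by (rule partial_cong_open[OF o x]) (simp add: g0)
    then show ?thesis
      using False by (simp add: hyp_laplace_def hyp_div_def test_outside_ball[OF test_partial] test_partial \<phi>)
  qed
qed

lemma test_hyp_laplace:
  fixes \<phi> :: "'a::euclidean_space \<Rightarrow> real"
  assumes "\<phi> \<in> test_functions" "DIM('a) \<ge> 2"
  shows "hyp_laplace \<phi> \<in> test_functions"
  unfolding hyp_laplace_test[OF assms]
  by (intro test_sum test_add test_scale test_inner_mult test_smooth_mult[OF cont_diff_inv_factor]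
      test_partial assms)

lemma partial_test_add:
  "\<phi> \<in> test_functions \<Longrightarrow> \<psi> \<in> test_functions \<Longrightarrow>
   partial b (\<lambda>x. \<phi> x + \<psi> x) = (\<lambda>x. partial b \<phi> x + partial b \<psi> x)"
  by (auto intro!: partial_add test_differentiable)

lemma partial_test_scale:
  "\<phi> \<in> test_functions \<Longrightarrow> partial b (\<lambda>x. r * \<phi> x) = (\<lambda>x. r * partial b \<phi> x)"
  by (simp add: partial_mult[where f="\<lambda>_. r"] test_differentiable fun_eq_iff)

lemma hyp_laplace_add:
  fixes \<phi> \<psi> :: "'a::euclidean_space \<Rightarrow> real"
  assumes "\<phi> \<in> test_functions" "\<psi> \<in> test_functions" "DIM('a) \<ge> 2"
  shows "hyp_laplace (\<lambda>x. \<phi> x + \<psi> x) = (\<lambda>x. hyp_laplace \<phi> x + hyp_laplace \<psi> x)"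
  using assms
  by (simp add: hyp_laplace_test test_add partial_test_add test_partial sum.distrib[symmetric] algebra_simps)

lemma hyp_laplace_scale:
  fixes \<phi> :: "'a::euclidean_space \<Rightarrow> real"
  assumes "\<phi> \<in> test_functions" "DIM('a) \<ge> 2"
  shows "hyp_laplace (\<lambda>x. r * \<phi> x) = (\<lambda>x. r * hyp_laplace \<phi> x)"
  using assms
  by (simp add: hyp_laplace_test test_scale partial_test_scale test_partial sum_distrib_left algebra_simps)

section \<open>Hyperbolic volume, Green's formula and the spectral gap\<close>

lemma space_hyp_vol [simp]: "space hyp_vol = ball 0 1"
  by (simp add: hyp_vol_def)

lemma sets_hyp_vol [measurable_cong]: "sets hyp_vol = sets (lebesgue_on (ball 0 1))"
  by (simp add: hyp_vol_def)

lemma borel_measurable_hyp_vol: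
  "f \<in> borel_measurable borel \<Longrightarrow> (f :: 'a::euclidean_space \<Rightarrow> real) \<in> borel_measurable hyp_vol"
  unfolding measurable_cong_sets[OF sets_hyp_vol refl]
  by (intro measurable_restrict_space1 measurable_completion) simp

lemma test_measurable: "\<phi> \<in> test_functions \<Longrightarrow> \<phi> \<in> borel_measurable borel"
  by (intro borel_measurable_continuous_onI test_continuous)

lemma hyp_factor_measurable [measurable]: "hyp_factor \<in> borel_measurable borel"
  unfolding hyp_factor_def by measurable

text \<open>The density times a test function is again a test function, so hyperbolic integrals
  become Euclidean ones to which integration by parts applies.\<close>

lemma hyp_vol_test:
  fixes \<phi> :: "'a::euclidean_space \<Rightarrow> real"
  assumes \<phi>: "\<phi> \<in> test_functions"
  shows "integrable hyp_vol \<phi>"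
    and "(\<integral>x. \<phi> x \<partial>hyp_vol) = (\<integral>x. hyp_factor x ^ DIM('a) * \<phi> x \<partial>lborel)"
proof -
  define g where "g x = hyp_factor x ^ DIM('a) * \<phi> x" for x
  have g: "g \<in> test_functions" unfolding g_def[abs_def] by (rule test_hyp_factor_power_mult[OF \<phi>])
  have m1: "\<phi> \<in> borel_measurable (lebesgue_on (ball 0 1))"
    "(\<lambda>x::'a. hyp_factor x ^ DIM('a)) \<in> borel_measurable (lebesgue_on (ball 0 1))"
    by (intro measurable_restrict_space1 measurable_completion; use test_measurable[OF \<phi>] in simp)+
  have pos: "AE x::'a in lebesgue_on (ball 0 1). 0 \<le> hyp_factor x ^ DIM('a)"
    by (rule AE_I2) (use hyp_factor_ge_2 in \<open>force intro!: zero_le_power\<close>)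
  have ind: "(\<lambda>x. indicator (ball 0 1) x *\<^sub>R g x) = g"
    using test_outside_ball[OF g] by (force simp: indicator_def)
  have gi: "integrable lborel g" by (rule test_integrable_lborel[OF g])
  have gm: "g \<in> borel_measurable lborel" using test_measurable[OF g] by simp
  have bs: "ball (0::'a) 1 \<inter> space lebesgue \<in> sets lebesgue" by simp
  have "integrable (lebesgue_on (ball 0 1)) g"
    unfolding integrable_restrict_space[OF bs] set_integrable_def[symmetric] ind
    using gi gm by (simp add: ind set_integrable_def integrable_completion)
  then show "integrable hyp_vol \<phi>"
    unfolding hyp_vol_def using m1 pos by (subst integrable_real_density) (auto simp: g_def[abs_def])
  have "(\<integral>x. \<phi> x \<partial>hyp_vol) = (\<integral>x. g x \<partial>lebesgue_on (ball 0 1))"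
    unfolding hyp_vol_def g_def using m1 pos by (subst integral_real_density) auto
  also have "\<dots> = (\<integral>x. g x \<partial>lborel)"
    unfolding integral_restrict_space[OF bs] ind by (rule integral_completion[OF gm])
  finally show "(\<integral>x. \<phi> x \<partial>hyp_vol) = (\<integral>x. hyp_factor x ^ DIM('a) * \<phi> x \<partial>lborel)"
    by (simp add: g_def)
qed

definition grad_form :: "('a::euclidean_space \<Rightarrow> real) \<Rightarrow> ('a \<Rightarrow> real) \<Rightarrow> 'a \<Rightarrow> real"
  where "grad_form \<phi> \<psi> x = (\<Sum>b\<in>Basis. partial b \<phi> x * partial b \<psi> x)"

lemma test_grad_form:
  "\<phi> \<in> test_functions \<Longrightarrow> \<psi> \<in> test_functions \<Longrightarrow> grad_form \<phi> \<psi> \<in> test_functions"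
  unfolding grad_form_def[abs_def] by (intro test_sum test_mult test_partial)

lemma grad_form_commute: "grad_form \<phi> \<psi> = grad_form \<psi> \<phi>"
  by (auto simp: grad_form_def mult.commute)

lemma integral_sum_partial_test:
  fixes \<phi> :: "'a::euclidean_space \<Rightarrow> 'a \<Rightarrow> real"
  assumes "\<And>b. b \<in> Basis \<Longrightarrow> \<phi> b \<in> test_functions"
  shows "integrable lborel (\<lambda>x. \<Sum>b\<in>Basis. partial b (\<phi> b) x)"
    and "(\<integral>x. (\<Sum>b\<in>Basis. partial b (\<phi> b) x) \<partial>lborel) = 0"
  using assms by (auto simp: integral_partial_test test_integrable_lborel test_partial intro!: Bochner_Integration.integrable_sum)

text \<open>With their densities, the two integrands differ by the Euclidean divergence of the
  compactly supported field \<open>X b * \<psi>\<close>, whose integral is 0. The right side is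
  symmetric, which later gives symmetry of \<open>gjms1\<close>.\<close>

lemma green:
  fixes \<phi> \<psi> :: "'a::euclidean_space \<Rightarrow> real"
  assumes \<phi>: "\<phi> \<in> test_functions" and \<psi>: "\<psi> \<in> test_functions" and dim: "DIM('a) \<ge> 2"
  shows "(\<integral>x. - hyp_laplace \<phi> x * \<psi> x \<partial>hyp_vol) =
    (\<integral>x. hyp_factor x ^ (DIM('a) - 2) * grad_form \<phi> \<psi> x \<partial>lborel)"
proof -
  define X where "X b = (\<lambda>x. hyp_factor x ^ (DIM('a) - 2) * partial b \<phi> x)" for b
  have X: "X b \<in> test_functions" if "b \<in> Basis" for b
    unfolding X_def by (intro test_hyp_factor_power_mult test_partial \<phi> that)
  have Lp: "(\<lambda>x. - hyp_laplace \<phi> x * \<psi> x) \<in> test_functions"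
    by (intro test_mult test_minus test_hyp_laplace \<phi> \<psi> dim)
  have eq: "hyp_factor x ^ DIM('a) * (- hyp_laplace \<phi> x * \<psi> x) =
    hyp_factor x ^ (DIM('a) - 2) * grad_form \<phi> \<psi> x - (\<Sum>b\<in>Basis. partial b (\<lambda>y. X b y * \<psi> y) x)" for x
  proof -
    have "partial b (\<lambda>y. X b y * \<psi> y) x = X b x * partial b \<psi> x + partial b (X b) x * \<psi> x" if "b \<in> Basis" for b
      by (intro partial_mult test_differentiable X that \<psi>)
    then have S: "(\<Sum>b\<in>Basis. partial b (\<lambda>y. X b y * \<psi> y) x) =
        hyp_factor x ^ (DIM('a) - 2) * grad_form \<phi> \<psi> x + (\<Sum>b\<in>Basis. partial b (X b) x) * \<psi> x"
      by (simp add: sum.distrib grad_form_def X_def sum_distrib_left sum_distrib_right mult.assoc)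
    show ?thesis
    proof (cases "x \<in> ball 0 1")
      case True
      then show ?thesis
        using S hyp_laplace_ball[OF \<phi> True dim] unfolding X_def by (simp add: mult.assoc[symmetric])
    next
      case False
      then show ?thesis using S test_outside_ball[OF \<psi> False] by simp
    qed
  qed
  show ?thesis
    unfolding hyp_vol_test(2)[OF Lp] eq
    using integral_sum_partial_test[of "\<lambda>b x. X b x * \<psi> x"] test_mult[OF X \<psi>]
      test_integrable_lborel[OF test_hyp_factor_power_mult[OF test_grad_form[OF \<phi> \<psi>], of "DIM('a) - 2"]]
    by simp
qed

text \<open>The spectral gap comes from expanding \<open>0 \<le> |\<nabla>\<phi> + (N - 1) / 2 * \<phi> f x|\<^sup>2\<close> with the conformal factor
  \<open>f\<close>, weighted by \<open>f ^ (N - 2)\<close>, and integrating the cross term by parts.\<close>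

lemma poincare:
  fixes \<phi> :: "'a::euclidean_space \<Rightarrow> real"
  assumes \<phi>: "\<phi> \<in> test_functions" and dim: "DIM('a) \<ge> 2"
  shows "((real DIM('a) - 1)\<^sup>2 / 4) * (\<integral>x. \<phi> x * \<phi> x \<partial>hyp_vol) \<le> (\<integral>x. - hyp_laplace \<phi> x * \<phi> x \<partial>hyp_vol)"
proof -
  obtain n where n: "DIM('a) = n + 2" using dim by (metis add.commute le_Suc_ex)
  define N where "N = real DIM('a)"
  have N: "N = real n + 2" by (simp add: N_def n)
  have pp: "(\<lambda>x. \<phi> x * \<phi> x) \<in> test_functions" by (intro test_mult \<phi>)
  \<comment> \<open>The vector field whose divergence contains the cross term of the square; its
    exponent is \<open>N - 1\<close>. Since the divergence integrates to 0, it may be added to the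
    pointwise inequality.\<close>
  define Y where "Y b = (\<lambda>x. hyp_factor x ^ Suc n * (x \<bullet> b * (\<phi> x * \<phi> x)))" for b
  have Y: "Y b \<in> test_functions" for b
    unfolding Y_def by (intro test_hyp_factor_power_mult test_inner_mult pp)
  have dY: "partial b (Y b) x = hyp_factor x ^ Suc n * (\<phi> x * \<phi> x + 2 * \<phi> x * (x \<bullet> b * partial b \<phi> x))
      + (N - 1) * (hyp_factor x ^ Suc (Suc n) * ((x \<bullet> b)\<^sup>2 * (\<phi> x * \<phi> x)))" if b: "b \<in> Basis" for b x
  proof -
    have "partial b (\<lambda>y. y \<bullet> b * (\<phi> y * \<phi> y)) x = \<phi> x * \<phi> x + 2 * \<phi> x * (x \<bullet> b * partial b \<phi> x)"
      using b test_differentiable[OF \<phi>, of x] test_differentiable[OF pp, of x]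
      by (subst partial_mult) (auto simp: partial_mult algebra_simps intro!: bounded_linear_imp_differentiable bounded_linear_inner_left)
    then show ?thesis
      unfolding Y_def test_partial_hyp_factor_power_mult(2)[OF test_inner_mult[OF pp]]
      by (simp add: N power2_eq_square algebra_simps)
  qed
  have pointwise: "(N - 1)\<^sup>2 / 4 * (hyp_factor x ^ DIM('a) * (\<phi> x * \<phi> x)) - (N - 1) / 2 * (\<Sum>b\<in>Basis. partial b (Y b) x)
    \<le> hyp_factor x ^ (DIM('a) - 2) * grad_form \<phi> \<phi> x" for x
  proof (cases "x \<in> ball 0 1")
    case False
    then show ?thesis
      by (simp add: test_outside_ball[OF \<phi>] test_outside_ball[OF test_partial[OF Y]] test_outside_ball[OF test_grad_form[OF \<phi> \<phi>]])
  next
    case True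
    define F p R X S where "F = hyp_factor x" and "p = \<phi> x" and "R = (\<Sum>b\<in>Basis. (x \<bullet> b)\<^sup>2)"
      and "X = (\<Sum>b\<in>Basis. x \<bullet> b * partial b \<phi> x)" and "S = grad_form \<phi> \<phi> x"
    have F: "F \<ge> 2" unfolding F_def by (rule hyp_factor_ge_2[OF True])
    have R: "F * (1 - R) = 2"
      using hyp_factor_inv_factor[OF True]
      by (simp add: F_def R_def inv_factor_def euclidean_inner[of x x] power2_eq_square)
    have sumY: "(\<Sum>b\<in>Basis. partial b (Y b) x) = F ^ Suc n * (N * p\<^sup>2 + 2 * p * X) + (N - 1) * (F ^ Suc (Suc n) * (R * p\<^sup>2))"
      by (simp add: dY sum.distrib F_def[symmetric] p_def[symmetric] sum_distrib_left[symmetric] sum_distrib_right[symmetric]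
         X_def[symmetric] R_def[symmetric] N_def power2_eq_square[of p] del: power_Suc)
    \<comment> \<open>The factor \<open>(N - 1) / 2\<close> maximises
      \<open>t * (N - 1) - t^2\<close>, the coefficient of \<open>F ^ N * p^2\<close> that remains
      after integration by parts.\<close>
    have "0 \<le> (\<Sum>b\<in>Basis. (partial b \<phi> x + (N - 1) / 2 * F * p * (x \<bullet> b))\<^sup>2)" by (intro sum_nonneg) auto
    also have "\<dots> = S + (N - 1) * F * p * X + (N - 1)\<^sup>2 / 4 * F\<^sup>2 * p\<^sup>2 * R"
    proof -
      have "(partial b \<phi> x + (N - 1) / 2 * F * p * (x \<bullet> b))\<^sup>2 = partial b \<phi> x * partial b \<phi> x
        + (N - 1) * F * p * (x \<bullet> b * partial b \<phi> x) + (N - 1)\<^sup>2 / 4 * F\<^sup>2 * p\<^sup>2 * (x \<bullet> b)\<^sup>2" for b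
        by (simp add: power2_sum power_mult_distrib power_divide) (simp add: power2_eq_square)
      then show ?thesis
        by (simp only: sum.distrib sum_distrib_left[symmetric] S_def grad_form_def X_def R_def)
    qed
    finally have sq: "0 \<le> S + (N - 1) * F * p * X + (N - 1)\<^sup>2 / 4 * F\<^sup>2 * p\<^sup>2 * R" .
    have "0 \<le> (N - 1) / 2 * F * p\<^sup>2" using F N by simp
    \<comment> \<open>The difference of the two sides is the square, a nonnegative surplus
      \<open>(N - 1) / 2 * F * p^2\<close>, and a multiple of \<open>2 - F * (1 - R)\<close>, which
      is 0 by the definition of the conformal factor.\<close>
    moreover have "S - ((N - 1)\<^sup>2 / 4 * F\<^sup>2 * p\<^sup>2 - (N - 1) / 2 * (F * (N * p\<^sup>2 + 2 * p * X) + (N - 1) * (F\<^sup>2 * (R * p\<^sup>2)))) =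
      (S + (N - 1) * F * p * X + (N - 1)\<^sup>2 / 4 * F\<^sup>2 * p\<^sup>2 * R) + (N - 1) / 2 * F * p\<^sup>2
      + (N - 1)\<^sup>2 / 4 * F * p\<^sup>2 * (2 - F * (1 - R))"
      by (simp add: field_simps power2_eq_square)
    ultimately have "(N - 1)\<^sup>2 / 4 * F\<^sup>2 * p\<^sup>2 - (N - 1) / 2 * (F * (N * p\<^sup>2 + 2 * p * X) + (N - 1) * (F\<^sup>2 * (R * p\<^sup>2))) \<le> S"
      using sq R by simp
    then have "F ^ n * ((N - 1)\<^sup>2 / 4 * F\<^sup>2 * p\<^sup>2 - (N - 1) / 2 * (F * (N * p\<^sup>2 + 2 * p * X) + (N - 1) * (F\<^sup>2 * (R * p\<^sup>2)))) \<le> F ^ n * S"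
      using F by (intro mult_left_mono) auto
    then show ?thesis
      unfolding sumY S_def[symmetric] F_def[symmetric] p_def[symmetric] n
      by (simp add: algebra_simps power2_eq_square)
  qed
  have int_sq: "integrable lborel (\<lambda>x. hyp_factor x ^ DIM('a) * (\<phi> x * \<phi> x))"
    by (rule test_integrable_lborel[OF test_hyp_factor_power_mult[OF pp]])
  note int_Y = integral_sum_partial_test[of Y, OF Y]
  have "(N - 1)\<^sup>2 / 4 * (\<integral>x. \<phi> x * \<phi> x \<partial>hyp_vol) =
    (\<integral>x. (N - 1)\<^sup>2 / 4 * (hyp_factor x ^ DIM('a) * (\<phi> x * \<phi> x)) - (N - 1) / 2 * (\<Sum>b\<in>Basis. partial b (Y b) x) \<partial>lborel)"
    unfolding hyp_vol_test(2)[OF pp] using int_sq int_Y by simp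
  also have "\<dots> \<le> (\<integral>x. hyp_factor x ^ (DIM('a) - 2) * grad_form \<phi> \<phi> x \<partial>lborel)"
    using int_sq int_Y pointwise test_integrable_lborel[OF test_hyp_factor_power_mult[OF test_grad_form[OF \<phi> \<phi>]]]
    by (intro integral_mono) simp_all
  also have "\<dots> = (\<integral>x. - hyp_laplace \<phi> x * \<phi> x \<partial>hyp_vol)" by (rule green[OF \<phi> \<phi> dim, symmetric])
  finally show ?thesis by (simp add: N_def)
qed

section \<open>Coercivity of the GJMS operator\<close>

text \<open>The constant \<open>1 / 4\<close> is the spectral gap \<open>(N - 1)^2 / 4\<close> minus
  the shift \<open>N * (N - 2) / 4\<close> in \<open>gjms1\<close>.\<close>

lemma positive_operator_gjms1:
  assumes dim: "DIM('a::euclidean_space) \<ge> 2"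
  shows "positive_operator hyp_vol (test_functions :: ('a \<Rightarrow> real) set) gjms1 (1 / 4)"
proof
  define d where "d = real DIM('a) * (real DIM('a) - 2) / 4"
  have gjms1: "gjms1 \<phi> x = - hyp_laplace \<phi> x - d * \<phi> x" for \<phi> :: "'a \<Rightarrow> real" and x
    by (simp add: gjms1_def d_def)
  fix \<phi> \<psi> :: "'a \<Rightarrow> real" and r :: real
  assume \<phi>: "\<phi> \<in> test_functions"
  note \<Delta> = test_minus[OF test_hyp_laplace[OF _ dim]]
  show "(\<lambda>x. r * \<phi> x) \<in> test_functions" by (rule test_scale[OF \<phi>])
  show "gjms1 \<phi> \<in> test_functions"
    unfolding gjms1 by (intro test_diff test_minus test_hyp_laplace test_scale \<phi> dim)
  show "gjms1 (\<lambda>x. r * \<phi> x) = (\<lambda>x. r * gjms1 \<phi> x)"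
    by (simp add: fun_eq_iff gjms1 hyp_laplace_scale[OF \<phi> dim] algebra_simps)
  have split: "(\<integral>x. gjms1 \<phi> x * \<psi> x \<partial>hyp_vol) =
      (\<integral>x. - hyp_laplace \<phi> x * \<psi> x \<partial>hyp_vol) - d * (\<integral>x. \<phi> x * \<psi> x \<partial>hyp_vol)"
    if "\<phi> \<in> test_functions" "\<psi> \<in> test_functions" for \<phi> \<psi> :: "'a \<Rightarrow> real"
  proof -
    have "integrable hyp_vol (\<lambda>x. - hyp_laplace \<phi> x * \<psi> x)" "integrable hyp_vol (\<lambda>x. d * (\<phi> x * \<psi> x))"
      by (intro integrable_mult_right hyp_vol_test(1) test_mult \<Delta> that)+
    from Bochner_Integration.integral_diff[OF this] show ?thesis
      by (simp add: gjms1 left_diff_distrib mult.assoc)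
  qed
  have "(real DIM('a) - 1)\<^sup>2 / 4 = d + 1 / 4"
    by (simp add: d_def power2_eq_square field_simps)
  then show "1 / 4 * (\<integral>x. \<phi> x * \<phi> x \<partial>hyp_vol) \<le> (\<integral>x. gjms1 \<phi> x * \<phi> x \<partial>hyp_vol)"
    using poincare[OF \<phi> dim] unfolding split[OF \<phi> \<phi>] by (simp add: distrib_right)
  assume \<psi>: "\<psi> \<in> test_functions"
  show "(\<lambda>x. \<phi> x + \<psi> x) \<in> test_functions" by (rule test_add[OF \<phi> \<psi>])
  show "integrable hyp_vol (\<lambda>x. \<phi> x * \<psi> x)" by (rule hyp_vol_test(1)[OF test_mult[OF \<phi> \<psi>]])
  show "gjms1 (\<lambda>x. \<phi> x + \<psi> x) = (\<lambda>x. gjms1 \<phi> x + gjms1 \<psi> x)"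
    by (simp add: fun_eq_iff gjms1 hyp_laplace_add[OF \<phi> \<psi> dim] algebra_simps)
  show "(\<integral>x. gjms1 \<phi> x * \<psi> x \<partial>hyp_vol) = (\<integral>x. \<phi> x * gjms1 \<psi> x \<partial>hyp_vol)"
    unfolding mult.commute[of "\<phi> x" "gjms1 \<psi> x" for x] split[OF \<phi> \<psi>] split[OF \<psi> \<phi>]
      green[OF \<phi> \<psi> dim] green[OF \<psi> \<phi> dim]
    by (simp add: grad_form_commute[of \<phi>] mult.commute[of "\<phi> x" for x])
qed simp

section \<open>The Sobolev norm against the GJMS form\<close>

text \<open>Reversed because \<open>gjms\<close> applies its factor with the largest shift first,
  and \<open>shifted_prod\<close> the head of its list.\<close>

definition gjms_shifts :: "nat \<Rightarrow> real list"
  where "gjms_shifts k = rev (map (\<lambda>j. real (Suc j * j)) [0..<k])"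

lemma gjms_eq_shifted_prod: "gjms k f = shifted_prod gjms1 (gjms_shifts k) f"
  by (induction k arbitrary: f) (auto simp: gjms_shifts_def)

lemma length_gjms_shifts: "length (gjms_shifts k) = k"
  by (simp add: gjms_shifts_def)

lemma gjms_shifts_nonneg: "a \<in> set (gjms_shifts k) \<Longrightarrow> 0 \<le> a"
  by (auto simp: gjms_shifts_def)

text \<open>The negative Laplacian is itself a shift of \<open>gjms1\<close>, so its powers are
  products with a constant list and become comparable with \<open>gjms k\<close>.\<close>

lemma hyp_laplace_funpow:
  fixes \<phi> :: "'a::euclidean_space \<Rightarrow> real"
  assumes dim: "DIM('a) \<ge> 2" and \<phi>: "\<phi> \<in> test_functions"
  shows "(hyp_laplace ^^ m) \<phi> =
    (\<lambda>x. (-1) ^ m * shifted_prod gjms1 (replicate m (real DIM('a) * (real DIM('a) - 2) / 4)) \<phi> x)"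
  using \<phi>
proof (induction m arbitrary: \<phi>)
  case (Suc m)
  interpret positive_operator hyp_vol "test_functions :: ('a \<Rightarrow> real) set" gjms1 "1 / 4"
    by (rule positive_operator_gjms1[OF dim])
  let ?d = "real DIM('a) * (real DIM('a) - 2) / 4"
  have eq: "hyp_laplace \<phi> = (\<lambda>x. (-1) * shifted ?d \<phi> x)"
    by (simp add: gjms1_def)
  have "(hyp_laplace ^^ Suc m) \<phi> = (hyp_laplace ^^ m) (\<lambda>x. (-1) * shifted ?d \<phi> x)"
    unfolding funpow_Suc_right comp_def eq ..
  also have "\<dots> = (\<lambda>x. (-1) ^ m * shifted_prod gjms1 (replicate m ?d) (\<lambda>x. (-1) * shifted ?d \<phi> x) x)"
    by (rule Suc.IH[OF T_scale[OF shifted_T[OF Suc.prems]]])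
  also have "\<dots> = (\<lambda>x. (-1) ^ Suc m * shifted_prod gjms1 (replicate (Suc m) ?d) \<phi> x)"
    unfolding shifted_prod_scale[OF shifted_T[OF Suc.prems]] by simp
  finally show ?case .
qed simp

text \<open>Every Sobolev term is the quadratic form of a power of the negative Laplacian. For even
  \<open>m\<close>, half of the factors move across by symmetry; for odd \<open>m\<close>, Green's
  formula first turns the gradient into one more Laplacian.\<close>

lemma integral_nabla_norm:
  fixes \<phi> :: "'a::euclidean_space \<Rightarrow> real"
  assumes dim: "DIM('a) \<ge> 2" and \<phi>: "\<phi> \<in> test_functions"
  shows "(\<integral>x. (hyp_nabla_norm m \<phi> x)\<^sup>2 \<partial>hyp_vol) =
    (\<integral>x. shifted_prod gjms1 (replicate m (real DIM('a) * (real DIM('a) - 2) / 4)) \<phi> x * \<phi> x \<partial>hyp_vol)"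
proof -
  interpret positive_operator hyp_vol "test_functions :: ('a \<Rightarrow> real) set" gjms1 "1 / 4"
    by (rule positive_operator_gjms1[OF dim])
  define d where "d = real DIM('a) * (real DIM('a) - 2) / 4"
  define S :: "nat \<Rightarrow> ('a \<Rightarrow> real) \<Rightarrow> 'a \<Rightarrow> real"
    where "S i = shifted_prod gjms1 (replicate i d)" for i
  have S_T: "S i \<psi> \<in> test_functions" if "\<psi> \<in> test_functions" for i and \<psi> :: "'a \<Rightarrow> real"
    unfolding S_def by (rule shifted_prod_T[OF that])
  have S_add: "S (i + j) \<psi> = S i (S j \<psi>)" for i j \<psi>
    unfolding S_def by (metis add.commute replicate_add shifted_prod_append)
  have S_ip: "ip (S i \<psi>) \<theta> = ip \<psi> (S i \<theta>)" if "\<psi> \<in> test_functions" "\<theta> \<in> test_functions" for i and \<psi> \<theta> :: "'a \<Rightarrow> real"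
    unfolding S_def by (rule ip_shifted_prod[OF that])
  have lap: "(hyp_laplace ^^ i) \<phi> = (\<lambda>x. (-1) ^ i * S i \<phi> x)" for i
    unfolding S_def d_def by (rule hyp_laplace_funpow[OF dim \<phi>])
  show ?thesis
  proof (cases "even m")
    case True
    then obtain i where m: "m = i + i" by (auto elim!: evenE simp: mult_2)
    have "(\<integral>x. (hyp_nabla_norm m \<phi> x)\<^sup>2 \<partial>hyp_vol) = ip (S i \<phi>) (S i \<phi>)"
    proof -
      have "(hyp_nabla_norm m \<phi> x)\<^sup>2 = S i \<phi> x * S i \<phi> x" for x
        using True by (simp add: hyp_nabla_norm_def lap m mult_2[symmetric] power_mult_distrib power_mult[symmetric] power2_eq_square[of "S i \<phi> x"] mult.commute[of i])
      then show ?thesis by (simp add: ip_def)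
    qed
    also have "\<dots> = ip (S m \<phi>) \<phi>"
      unfolding m S_add by (rule S_ip[symmetric]) (intro S_T \<phi>)+
    finally show ?thesis by (simp add: ip_def S_def d_def)
  next
    case False
    then obtain i where m: "m = Suc (i + i)" by (auto elim!: oddE simp: mult_2)
    define \<psi> where "\<psi> = (hyp_laplace ^^ i) \<phi>"
    have \<psi>: "\<psi> \<in> test_functions" unfolding \<psi>_def lap by (intro test_scale S_T \<phi>)
    \<comment> \<open>The squared hyperbolic length of the gradient carries
      \<open>hyp_factor\<close> to the power \<open>2 - 4\<close>; with \<open>inv_factor\<close> it
      becomes a test function on the whole space.\<close>
    define g where "g x = inv_factor x * (inv_factor x * grad_form \<psi> \<psi> x)" for x
    have g: "g \<in> test_functions" unfolding g_def[abs_def]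
      by (intro test_smooth_mult[OF cont_diff_inv_factor] test_grad_form \<psi>)
    have "(\<integral>x. (hyp_nabla_norm m \<phi> x)\<^sup>2 \<partial>hyp_vol) = (\<integral>x. g x \<partial>hyp_vol)"
    proof (rule Bochner_Integration.integral_cong[OF refl])
      fix x :: 'a assume "x \<in> space hyp_vol"
      then have FG: "hyp_factor x * inv_factor x = 1" by (intro hyp_factor_inv_factor) simp
      have "(m - 1) div 2 = i" using m by simp
      then have "(hyp_nabla_norm m \<phi> x)\<^sup>2 = (hyp_factor x)\<^sup>2 * (norm (hyp_grad \<psi> x))\<^sup>2"
        using False by (simp add: hyp_nabla_norm_def \<psi>_def power_mult_distrib)
      also have "(norm (hyp_grad \<psi> x))\<^sup>2 = (\<Sum>b\<in>Basis. (hyp_grad \<psi> x \<bullet> b)\<^sup>2)"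
        unfolding power2_norm_eq_inner
        by (subst euclidean_inner) (simp add: power2_eq_square)
      also have "\<dots> = grad_form \<psi> \<psi> x / (hyp_factor x ^ 2)\<^sup>2"
        by (simp add: hyp_grad_inner grad_form_def power_divide sum_divide_distrib power2_eq_square)
      also have "(hyp_factor x)\<^sup>2 * (grad_form \<psi> \<psi> x / (hyp_factor x ^ 2)\<^sup>2) = g x"
      proof -
        have F: "hyp_factor x \<noteq> 0" using FG by auto
        then have G: "inv_factor x = 1 / hyp_factor x" using FG by (simp add: nonzero_eq_divide_eq mult.commute)
        show ?thesis unfolding g_def G using F by (simp add: power2_eq_square)
      qed
      finally show "(hyp_nabla_norm m \<phi> x)\<^sup>2 = g x" .
    qed
    also have "\<dots> = (\<integral>x. hyp_factor x ^ (DIM('a) - 2) * grad_form \<psi> \<psi> x \<partial>lborel)"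
      unfolding hyp_vol_test(2)[OF g]
    proof (rule Bochner_Integration.integral_cong[OF refl])
      fix x :: 'a
      obtain n where n: "DIM('a) = n + 2" using dim by (metis add.commute le_Suc_ex)
      show "hyp_factor x ^ DIM('a) * g x = hyp_factor x ^ (DIM('a) - 2) * grad_form \<psi> \<psi> x"
      proof (cases "x \<in> ball 0 1")
        case True
        have "hyp_factor x ^ DIM('a) * g x = hyp_factor x ^ n * (hyp_factor x * inv_factor x) * (hyp_factor x * inv_factor x) * grad_form \<psi> \<psi> x"
          by (simp add: n g_def)
        then show ?thesis using hyp_factor_inv_factor[OF True] by (simp add: n)
      qed (simp add: test_outside_ball[OF g] test_outside_ball[OF test_grad_form[OF \<psi> \<psi>]])
    qed
    also have "\<dots> = (\<integral>x. - hyp_laplace \<psi> x * \<psi> x \<partial>hyp_vol)"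
      by (rule green[OF \<psi> \<psi> dim, symmetric])
    also have "\<dots> = ip (S (Suc i) \<phi>) (S i \<phi>)"
    proof -
      have "hyp_laplace \<psi> = (hyp_laplace ^^ Suc i) \<phi>" by (simp add: \<psi>_def)
      then have "- hyp_laplace \<psi> x * \<psi> x = S (Suc i) \<phi> x * S i \<phi> x" for x
        unfolding \<psi>_def lap by (simp add: power_mult_distrib[symmetric] mult.left_commute)
      then show ?thesis by (simp add: ip_def)
    qed
    also have "\<dots> = ip (S m \<phi>) \<phi>"
    proof -
      have "S m \<phi> = S i (S (Suc i) \<phi>)" unfolding S_add[symmetric] by (simp add: m)
      then show ?thesis by (simp add: S_ip S_T \<phi>)
    qed
    finally show ?thesis by (simp add: ip_def S_def d_def)
  qed
qed

text \<open>The term of order \<open>m\<close> has degree \<open>m \<le> k\<close> in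
  \<open>gjms1\<close> and nonnegative shifts, so it is dominated by the product of degree
  \<open>k\<close>.\<close>

lemma sobolev_norm_le_gjms:
  assumes dim: "DIM('a::euclidean_space) \<ge> 2"
  obtains C where "0 < C" "\<And>\<phi> :: 'a \<Rightarrow> real. \<phi> \<in> test_functions \<Longrightarrow>
    (sobolev_norm k \<phi>)\<^sup>2 \<le> C * (\<integral>x. \<phi> x * gjms k \<phi> x \<partial>hyp_vol)"
proof -
  interpret positive_operator hyp_vol "test_functions :: ('a \<Rightarrow> real) set" gjms1 "1 / 4"
    by (rule positive_operator_gjms1[OF dim])
  define d where "d = real DIM('a) * (real DIM('a) - 2) / 4"
  have d: "0 \<le> d" using dim by (simp add: d_def)
  have "\<exists>C>0. \<forall>\<phi>::'a \<Rightarrow> real\<in>test_functions. ip (shifted_prod gjms1 (replicate m d) \<phi>) \<phi> \<le> C * ip (gjms k \<phi>) \<phi>"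
    if "m \<le> k" for m
    using shifted_prod_compare[of "replicate m d" "gjms_shifts k"] d that
    by (simp add: length_gjms_shifts gjms_shifts_nonneg gjms_eq_shifted_prod) metis
  then obtain C where C: "\<And>m. m \<le> k \<Longrightarrow> 0 < C m"
    "\<And>m \<phi>. m \<le> k \<Longrightarrow> \<phi> \<in> test_functions \<Longrightarrow>
      ip (shifted_prod gjms1 (replicate m d) \<phi>) \<phi> \<le> C m * ip (gjms k \<phi>) \<phi>" by metis
  show thesis
  proof (rule that[of "\<Sum>m\<le>k. C m"])
    show "0 < (\<Sum>m\<le>k. C m)" using C(1) by (intro sum_pos) auto
    fix \<phi> :: "'a \<Rightarrow> real" assume \<phi>: "\<phi> \<in> test_functions"
    have "(sobolev_norm k \<phi>)\<^sup>2 = (\<Sum>m\<le>k. \<integral>x. (hyp_nabla_norm m \<phi> x)\<^sup>2 \<partial>hyp_vol)"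
      unfolding sobolev_norm_def by (intro real_sqrt_pow2 sum_nonneg) simp
    also have "\<dots> = (\<Sum>m\<le>k. ip (shifted_prod gjms1 (replicate m d) \<phi>) \<phi>)"
      by (simp add: integral_nabla_norm[OF dim \<phi>] ip_def d_def)
    also have "\<dots> \<le> (\<Sum>m\<le>k. C m * ip (gjms k \<phi>) \<phi>)"
      by (intro sum_mono C(2) \<phi>) auto
    finally show "(sobolev_norm k \<phi>)\<^sup>2 \<le> (\<Sum>m\<le>k. C m) * (\<integral>x. \<phi> x * gjms k \<phi> x \<partial>hyp_vol)"
      by (simp add: sum_distrib_right ip_def mult.commute[of "\<phi> x" for x])
  qed
qed

section \<open>Locally integrable coefficients\<close>

text \<open>The restrictions to closed balls of radius \<open>1 - 1 / (n + 1)\<close> are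
  integrable, and at each point of the unit ball they eventually equal \<open>f\<close>.\<close>

lemma hyp_locally_integrable_measurable:
  fixes f :: "'a::euclidean_space \<Rightarrow> real"
  assumes "hyp_locally_integrable f"
  shows "f \<in> borel_measurable hyp_vol"
proof (rule borel_measurable_LIMSEQ_real)
  define r where "r n = 1 - 1 / real (Suc n)" for n
  have r: "r n < 1" for n by (simp add: r_def)
  show "(\<lambda>x. indicator (cball 0 (r n)) x *\<^sub>R f x) \<in> borel_measurable hyp_vol" for n
  proof -
    have "compact (cball 0 (r n) :: 'a set)" "cball 0 (r n) \<subseteq> (ball 0 1 :: 'a set)"
      using r[of n] by auto
    then have "set_integrable hyp_vol (cball 0 (r n)) f"
      using assms unfolding hyp_locally_integrable_def by blast
    then show ?thesis unfolding set_integrable_def by auto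
  qed
  fix x :: 'a assume "x \<in> space hyp_vol"
  then have x: "0 < 1 - norm x" by simp
  then obtain n0 where n0: "inverse (real (Suc n0)) < 1 - norm x" using reals_Archimedean by blast
  have "indicator (cball 0 (r n)) x *\<^sub>R f x = f x" if "n \<ge> n0" for n
  proof -
    have "1 / real (Suc n) \<le> 1 / real (Suc n0)" using that by (simp add: frac_le)
    with n0 have "norm x \<le> r n" by (simp add: r_def inverse_eq_divide)
    then show ?thesis by simp
  qed
  then show "(\<lambda>n. indicator (cball 0 (r n)) x *\<^sub>R f x) \<longlonglongrightarrow> f x"
    by (intro tendsto_eventually) (auto simp: eventually_sequentially)
qed

text \<open>The set where \<open>\<phi>\<close> is nonzero is in general not compact; integrability
  is inherited from a compact set containing it.\<close>

lemma integrable_support_test: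
  assumes "hyp_locally_integrable f" and "\<phi> \<in> test_functions"
  shows "integrable hyp_vol (\<lambda>x. f x * indicator {x. \<phi> x \<noteq> 0} x)"
proof -
  obtain K where K: "compact K" "K \<subseteq> ball 0 1" "\<And>x. x \<notin> K \<Longrightarrow> \<phi> x = 0"
    using assms(2) by (metis test_support)
  have fK: "integrable hyp_vol (\<lambda>x. indicator K x *\<^sub>R f x)"
    using assms(1) K unfolding hyp_locally_integrable_def set_integrable_def by blast
  have [measurable]: "f \<in> borel_measurable hyp_vol" by (rule hyp_locally_integrable_measurable[OF assms(1)])
  have [measurable]: "\<phi> \<in> borel_measurable hyp_vol"
    by (rule borel_measurable_hyp_vol[OF test_measurable[OF assms(2)]])
  show ?thesis
  proof (rule Bochner_Integration.integrable_bound[OF fK])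
    have "(\<lambda>x. if \<phi> x \<noteq> 0 then f x else 0) \<in> borel_measurable hyp_vol" by measurable
    also have "(\<lambda>x. if \<phi> x \<noteq> 0 then f x else 0) = (\<lambda>x. f x * indicator {x. \<phi> x \<noteq> 0} x)" by auto
    finally show "(\<lambda>x. f x * indicator {x. \<phi> x \<noteq> 0} x) \<in> borel_measurable hyp_vol" .
  qed (use K(3) in \<open>auto simp: indicator_def\<close>)
qed

section \<open>Existence for the GJMS equation\<close>

theorem theorem5p3:
  fixes k :: nat and Q1 Q2 :: "'a::euclidean_space \<Rightarrow> real"
  assumes "k \<ge> 1" and "DIM('a) = 2 * k"
    and "hyp_locally_integrable Q2"
    and "(\<lambda>x. Q1 x - Q2 x) \<in> hyp_L2"
    and "AE x in hyp_vol. Q2 x \<le> 0"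
  shows "\<exists>u \<in> hyp_sobolev k. weak_solution k Q1 Q2 u"
proof -
  have dim: "DIM('a) \<ge> 2" using assms(1,2) by simp
  \<comment> \<open>The sign of \<open>Q2\<close> is known almost everywhere only, while the
    variational problem asks for \<open>w\<close> nonnegative at every point.\<close>
  define w where "w x = max 0 (- Q2 x)" for x
  define h where "h x = Q1 x - Q2 x" for x
  interpret op: positive_operator hyp_vol "test_functions :: ('a \<Rightarrow> real) set" gjms1 "1 / 4"
    by (rule positive_operator_gjms1[OF dim])
  have Q2 [measurable]: "Q2 \<in> borel_measurable hyp_vol"
    by (rule hyp_locally_integrable_measurable[OF assms(3)])
  have h: "h \<in> borel_measurable hyp_vol" "integrable hyp_vol (\<lambda>x. (h x)\<^sup>2)"
    using assms(4) by (auto simp: hyp_L2_def h_def[abs_def])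
  have w_meas [measurable]: "w \<in> borel_measurable hyp_vol"
    unfolding w_def[abs_def] by measurable
  have w_Q2: "AE x in hyp_vol. w x = - Q2 x"
    using assms(5) by eventually_elim (simp add: w_def)
  obtain C where C: "0 < C" "\<And>\<phi> :: 'a \<Rightarrow> real. \<phi> \<in> test_functions \<Longrightarrow>
      (sobolev_norm k \<phi>)\<^sup>2 \<le> C * (\<integral>x. \<phi> x * gjms k \<phi> x \<partial>hyp_vol)"
    using sobolev_norm_le_gjms[OF dim] by blast
  interpret coercive_problem hyp_vol "test_functions :: ('a \<Rightarrow> real) set" "gjms k" h w "1 / C"
  proof
    fix \<phi> \<psi> :: "'a \<Rightarrow> real" and r :: real
    assume \<phi>: "\<phi> \<in> test_functions"
    show "\<phi> \<in> borel_measurable hyp_vol" by (rule borel_measurable_hyp_vol[OF test_measurable[OF \<phi>]])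
    show "\<exists>C. \<forall>x. \<bar>\<phi> x\<bar> \<le> C" using test_bounded[OF \<phi>] by metis
    show "integrable hyp_vol (\<lambda>x. (\<phi> x)\<^sup>2)"
      using hyp_vol_test(1)[OF test_mult[OF \<phi> \<phi>]] by (simp add: power2_eq_square)
    show "gjms k \<phi> \<in> test_functions"
      unfolding gjms_eq_shifted_prod by (rule op.shifted_prod_T[OF \<phi>])
    show "gjms k (\<lambda>x. r * \<phi> x) = (\<lambda>x. r * gjms k \<phi> x)"
      unfolding gjms_eq_shifted_prod by (rule op.shifted_prod_scale[OF \<phi>])
    \<comment> \<open>The \<open>L^2\<close> norm is the term of order 0 in the Sobolev norm, so the
      Sobolev bound already contains coercivity with constant \<open>1 / C\<close>.\<close>
    have "(\<integral>x. (\<phi> x)\<^sup>2 \<partial>hyp_vol) \<le> (sobolev_norm k \<phi>)\<^sup>2"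
    proof -
      have "(\<integral>x. (\<phi> x)\<^sup>2 \<partial>hyp_vol) = (\<integral>x. (hyp_nabla_norm 0 \<phi> x)\<^sup>2 \<partial>hyp_vol)"
        by (simp add: hyp_nabla_norm_def)
      also have "\<dots> \<le> (\<Sum>m\<le>k. \<integral>x. (hyp_nabla_norm m \<phi> x)\<^sup>2 \<partial>hyp_vol)"
        by (rule member_le_sum) auto
      also have "\<dots> = (sobolev_norm k \<phi>)\<^sup>2"
        unfolding sobolev_norm_def by (intro real_sqrt_pow2[symmetric] sum_nonneg) simp
      finally show ?thesis .
    qed
    with C(2)[OF \<phi>] C(1)
    show "1 / C * (\<integral>x. (\<phi> x)\<^sup>2 \<partial>hyp_vol) \<le> (\<integral>x. \<phi> x * gjms k \<phi> x \<partial>hyp_vol)"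
      by (simp add: field_simps)
    have "integrable hyp_vol (\<lambda>x. - Q2 x * indicator {x. \<phi> x \<noteq> 0} x)"
      using integrable_support_test[OF assms(3) \<phi>] by simp
    from Bochner_Integration.integrable_max[OF Bochner_Integration.integrable_zero this]
    have "integrable hyp_vol (\<lambda>x. max 0 (- Q2 x * indicator {x. \<phi> x \<noteq> 0} x))" .
    also have "(\<lambda>x. max 0 (- Q2 x * indicator {x. \<phi> x \<noteq> 0} x)) = (\<lambda>x. w x * indicator {x. \<phi> x \<noteq> 0} x)"
      by (auto simp: w_def indicator_def)
    finally show "integrable hyp_vol (\<lambda>x. w x * indicator {x. \<phi> x \<noteq> 0} x)" .
    assume \<psi>: "\<psi> \<in> test_functions"
    show "gjms k (\<lambda>x. \<phi> x + \<psi> x) = (\<lambda>x. gjms k \<phi> x + gjms k \<psi> x)"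
      unfolding gjms_eq_shifted_prod by (rule op.shifted_prod_add[OF \<phi> \<psi>])
    show "(\<integral>x. \<phi> x * gjms k \<psi> x \<partial>hyp_vol) = (\<integral>x. \<psi> x * gjms k \<phi> x \<partial>hyp_vol)"
      using op.ip_shifted_prod[OF \<phi> \<psi>, of "gjms_shifts k"]
      by (simp add: op.ip_def gjms_eq_shifted_prod mult.commute[of "\<psi> x" for x])
  qed (use C(1) h in \<open>auto simp: test_zero test_add test_scale w_def[abs_def]\<close>)
  obtain u \<psi> where u: "u \<in> borel_measurable hyp_vol" "integrable hyp_vol (\<lambda>x. (u x)\<^sup>2)"
    and \<psi>: "\<And>n. \<psi> n \<in> test_functions" "(\<lambda>n. \<integral>x. (\<psi> n x - u x)\<^sup>2 \<partial>hyp_vol) \<longlonglongrightarrow> 0"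
    and cauchy: "\<And>e. e > 0 \<Longrightarrow> \<exists>N. \<forall>m\<ge>N. \<forall>n\<ge>N.
      (\<integral>x. (\<psi> m x - \<psi> n x) * gjms k (\<lambda>x. \<psi> m x - \<psi> n x) x \<partial>hyp_vol) < e"
    and eqn: "\<And>v. v \<in> test_functions \<Longrightarrow> integrable hyp_vol (\<lambda>x. u x * gjms k v x)"
      "\<And>v. v \<in> test_functions \<Longrightarrow> integrable hyp_vol (\<lambda>x. (h x + w x * (exp (2 * u x) - 1)) * v x)"
      "\<And>v. v \<in> test_functions \<Longrightarrow> (\<integral>x. u x * gjms k v x \<partial>hyp_vol)
        + (\<integral>x. (h x + w x * (exp (2 * u x) - 1)) * v x \<partial>hyp_vol) = 0"
    using weak_solution_exists by blast
  have "u \<in> hyp_sobolev k"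
    unfolding hyp_sobolev_def hyp_L2_def
  proof (intro CollectI conjI exI[of _ \<psi>] allI impI u \<psi>)
    fix e :: real assume e: "0 < e"
    \<comment> \<open>The squared Sobolev norm is at most \<open>C\<close> times the form, hence the
      threshold \<open>e^2 / C\<close>.\<close>
    then obtain N where N: "\<And>m n. m \<ge> N \<Longrightarrow> n \<ge> N \<Longrightarrow>
        (\<integral>x. (\<psi> m x - \<psi> n x) * gjms k (\<lambda>x. \<psi> m x - \<psi> n x) x \<partial>hyp_vol) < e\<^sup>2 / C"
      using cauchy[of "e\<^sup>2 / C"] C(1) by auto
    have "sobolev_norm k (\<lambda>x. \<psi> m x - \<psi> n x) < e" if "m \<ge> N" "n \<ge> N" for m n
    proof (rule power2_less_imp_less)
      have "(sobolev_norm k (\<lambda>x. \<psi> m x - \<psi> n x))\<^sup>2 \<le>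
          C * (\<integral>x. (\<psi> m x - \<psi> n x) * gjms k (\<lambda>x. \<psi> m x - \<psi> n x) x \<partial>hyp_vol)"
        by (rule C(2)[OF test_diff[OF \<psi>(1) \<psi>(1)]])
      also have "\<dots> < e\<^sup>2" using N[OF that] C(1) by (simp add: field_simps)
      finally show "(sobolev_norm k (\<lambda>x. \<psi> m x - \<psi> n x))\<^sup>2 < e\<^sup>2" .
    qed (use e in simp)
    then show "\<exists>M. \<forall>m\<ge>M. \<forall>n\<ge>M. sobolev_norm k (\<lambda>x. \<psi> m x - \<psi> n x) < e" by blast
  qed
  moreover have "weak_solution k Q1 Q2 u"
    unfolding weak_solution_def
  proof (intro ballI conjI)
    fix v :: "'a \<Rightarrow> real" assume v: "v \<in> test_functions"
    have [measurable]: "v \<in> borel_measurable hyp_vol"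
      by (rule borel_measurable_hyp_vol[OF test_measurable[OF v]])
    note [measurable] = u(1) h(1)
    \<comment> \<open>Where \<open>w = - Q2\<close>, the summand \<open>- Q2\<close> in
      \<open>h\<close> cancels the constant part of \<open>w * (exp (2 * u) - 1)\<close>.\<close>
    have ae: "AE x in hyp_vol. (h x + w x * (exp (2 * u x) - 1)) * v x = (Q1 x - Q2 x * exp (2 * u x)) * v x"
      using w_Q2 by eventually_elim (simp add: h_def algebra_simps)
    have [measurable]: "Q1 \<in> borel_measurable hyp_vol"
    proof -
      have "(\<lambda>x. h x + Q2 x) \<in> borel_measurable hyp_vol" by measurable
      then show ?thesis by (simp add: h_def)
    qed
    have m: "(\<lambda>x. (h x + w x * (exp (2 * u x) - 1)) * v x) \<in> borel_measurable hyp_vol"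
      "(\<lambda>x. (Q1 x - Q2 x * exp (2 * u x)) * v x) \<in> borel_measurable hyp_vol"
      by measurable
    show "integrable hyp_vol (\<lambda>x. u x * gjms k v x)" by (rule eqn(1)[OF v])
    show "integrable hyp_vol (\<lambda>x. (Q1 x - Q2 x * exp (2 * u x)) * v x)"
      using eqn(2)[OF v] integrable_cong_AE[OF m ae] by simp
    show "(\<integral>x. u x * gjms k v x \<partial>hyp_vol) + (\<integral>x. (Q1 x - Q2 x * exp (2 * u x)) * v x \<partial>hyp_vol) = 0"
      using eqn(3)[OF v] integral_cong_AE[OF m ae] by simp
  qed
  ultimately show ?thesis by blast
qed

end
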